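(* Let $n\geqslant 5$, $p\geqslant1$, and let $\mathcal{U}=(u_1,\dots,u_p)$ be a nonnegative non-singular solution to $$\Delta^{2} u_{i}=c(n)|\mathcal{U}|^{2^{**}-2}u_{i} \quad \text{in } \mathbb{R}^{n}\setminus\{0\},\qquad i=1,\dots,p .$$ Then, for any $i\in I=\{1,\dots,p\}$, either $u_i\equiv0$ or $u_i>0$. In other words, $I=I_0\cup I_+$ is a disjoint union, where $I_0=\{i\in I:u_i\equiv0\}$ and $I_+=\{i\in I:u_i>0\}$.
   Context: Here $2^{**}=\frac{2n}{n-4}$, $c(n)=\frac{n(n-4)(n^2-4)}{16}$, $|\mathcal{U}|=(\sum_{i=1}^p u_i^2)^{1/2}$. A (classical) solution is a map $\mathcal{U}:\mathbb{R}^n\setminus\{0\}\to\mathbb{R}^p$ whose components belong to $C^{4,\zeta}(\mathbb{R}^n\setminus\{0\})$ for some $\zeta\in(0,1)$ and satisfy the system pointwise; it is nonnegative if $u_i\geqslant0$ for all $i$. It is non-singular if the origin is a removable singularity of every component, i.e. $\mathcal{U}$ extends continuously to $\mathbb{R}^n$ (it is then identified with its extension, which solves the system in all of $\mathbb{R}^n$). *)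

theory Defs
  imports "HOL-Analysis.Analysis"
begin

definition partial_deriv :: "'n::finite \<Rightarrow> (real^'n \<Rightarrow> real) \<Rightarrow> real^'n \<Rightarrow> real" where
  "partial_deriv j f x = deriv (\<lambda>t. f (x + t *\<^sub>R axis j 1)) 0"

definition has_partial_at :: "'n::finite \<Rightarrow> (real^'n \<Rightarrow> real) \<Rightarrow> real^'n \<Rightarrow> bool" where
  "has_partial_at j f x \<longleftrightarrow> (\<lambda>t. f (x + t *\<^sub>R axis j 1)) field_differentiable (at 0)"

text \<open>Class \<open>C\<^sup>k\<close> on an open set \<open>S\<close>: all partial derivatives up to order \<open>k\<close> exist
  and are continuous.\<close>

primrec Ck_on :: "nat \<Rightarrow> (real^'n::finite) set \<Rightarrow> (real^'n \<Rightarrow> real) \<Rightarrow> bool" where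
  "Ck_on 0 S f \<longleftrightarrow> continuous_on S f"
| "Ck_on (Suc k) S f \<longleftrightarrow> continuous_on S f \<and>
     (\<forall>j. (\<forall>x\<in>S. has_partial_at j f x) \<and> Ck_on k S (partial_deriv j f))"

definition locally_Holder_on :: "real \<Rightarrow> ('a::metric_space) set \<Rightarrow> ('a \<Rightarrow> real) \<Rightarrow> bool" where
  "locally_Holder_on \<zeta> S f \<longleftrightarrow>
     (\<forall>K. compact K \<and> K \<subseteq> S \<longrightarrow>
        (\<exists>C. \<forall>x\<in>K. \<forall>y\<in>K. \<bar>f x - f y\<bar> \<le> C * dist x y powr \<zeta>))"

text \<open>The space \<open>C\<^bsup>k,\<zeta>\<^esup>(S)\<close> for open \<open>S\<close>, with the usual convention that the Hoelder
  condition on the derivatives of order \<open>k\<close> is required on compact subsets of \<open>S\<close>.\<close>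

definition Ck_Holder_on ::
    "nat \<Rightarrow> real \<Rightarrow> (real^'n::finite) set \<Rightarrow> (real^'n \<Rightarrow> real) \<Rightarrow> bool" where
  "Ck_Holder_on k \<zeta> S f \<longleftrightarrow> Ck_on k S f \<and>
     (\<forall>js. length js = k \<longrightarrow> locally_Holder_on \<zeta> S (foldr partial_deriv js f))"

definition laplacian :: "(real^'n::finite \<Rightarrow> real) \<Rightarrow> real^'n \<Rightarrow> real" where
  "laplacian f x = (\<Sum>j\<in>UNIV. partial_deriv j (partial_deriv j f) x)"

definition crit_exp :: "nat \<Rightarrow> real" where
  "crit_exp n = 2 * real n / (real n - 4)"

definition c_const :: "nat \<Rightarrow> real" where
  "c_const n = real n * (real n - 4) * ((real n)\<^sup>2 - 4) / 16"

text \<open>A map on the punctured space is a total function whose value at the origin is never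
  used; in particular, the derivatives below at \<open>x \<noteq> 0\<close> depend only on values near \<open>x\<close>.\<close>

definition classical_solution :: "(real^'n::finite \<Rightarrow> real^'p::finite) \<Rightarrow> bool" where
  "classical_solution U \<longleftrightarrow>
     (\<exists>\<zeta>. 0 < \<zeta> \<and> \<zeta> < 1 \<and> (\<forall>i. Ck_Holder_on 4 \<zeta> (UNIV - {0}) (\<lambda>x. U x $ i))) \<and>
     (\<forall>i. \<forall>x\<in>UNIV - {0}. laplacian (laplacian (\<lambda>y. U y $ i)) x =
        c_const CARD('n) * norm (U x) powr (crit_exp CARD('n) - 2) * U x $ i)"

definition nonnegative :: "(real^'n::finite \<Rightarrow> real^'p::finite) \<Rightarrow> bool" where
  "nonnegative U \<longleftrightarrow> (\<forall>i. \<forall>x\<in>UNIV - {0}. 0 \<le> U x $ i)"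

definition non_singular :: "(real^'n::finite \<Rightarrow> real^'p::finite) \<Rightarrow> bool" where
  "non_singular U \<longleftrightarrow> (\<exists>V. continuous_on UNIV V \<and> (\<forall>x\<in>UNIV - {0}. V x = U x))"

definition extension :: "(real^'n::finite \<Rightarrow> real^'p::finite) \<Rightarrow> real^'n \<Rightarrow> real^'p" where
  "extension U x = (if x = 0 then Lim (at 0) U else U x)"

lemma extension_eq:
  fixes U V :: "real^'n::finite \<Rightarrow> real^'p::finite"
  assumes "continuous_on UNIV V" and "\<forall>x\<in>UNIV - {0}. V x = U x"
  shows "extension U = V"
proof
  fix x
  have "(V \<longlongrightarrow> V 0) (at 0)"
    using assms(1) by (simp add: continuous_on_def)
  moreover have "eventually (\<lambda>y. V y = U y) (at 0)"
    using assms(2) by (simp add: eventually_at_filter)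
  ultimately have "(U \<longlongrightarrow> V 0) (at 0)"
    by (rule Lim_transform_eventually)
  then have "Lim (at 0) U = V 0"
    by (intro tendsto_Lim) auto
  then show "extension U x = V x"
    using assms(2) by (simp add: extension_def)
qed

end

theory Submission
  imports Defs
begin

text \<open>
  Let \<open>v\<close> be a component of the continuous extension of \<open>U\<close> and suppose that \<open>v z = 0\<close>. Write \<open>n\<close> for
  the dimension and \<open>\<Delta>\<^sup>2\<close> for the bilaplacian. As \<open>\<bar>U\<bar> \<ge> v \<ge> 0\<close>, the system gives
  \<open>\<Delta>\<^sup>2 v \<ge> K v\<^sup>s\<close> away from the origin, with \<open>K > 0\<close> and \<open>s = (n + 4) / (n - 4) > 1\<close>. A fourth order
  equation has no maximum principle of its own, so the power on the right-hand side has to be used: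
  the proof shows that \<open>\<integral> v\<^sup>s \<bar>x - z\<bar>\<^sup>-\<^sup>(\<^sup>n\<^sup>-\<^sup>4\<^sup>) = 0\<close>, hence \<open>v = 0\<close> everywhere.

  The inequality is tested with the fundamental solution \<open>\<bar>x - z\<bar>\<^sup>-\<^sup>(\<^sup>n\<^sup>-\<^sup>4\<^sup>)\<close> of \<open>\<Delta>\<^sup>2\<close> with pole at the zero
  \<open>z\<close>, cut off at distance \<open>T\<close> from \<open>z\<close>. Its bilaplacian consists of a multiple of the point mass at
  \<open>z\<close>, which does not see \<open>v\<close> because \<open>v z = 0\<close>, and of an error of size \<open>T\<^sup>-\<^sup>4 \<bar>x - z\<bar>\<^sup>-\<^sup>(\<^sup>n\<^sup>-\<^sup>4\<^sup>)\<close> coming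
  from the cutoff. Young's inequality absorbs the error into half of \<open>K \<integral> v\<^sup>s \<bar>x - z\<bar>\<^sup>-\<^sup>(\<^sup>n\<^sup>-\<^sup>4\<^sup>)\<close>; since
  \<open>\<bar>x - z\<bar>\<^sup>-\<^sup>(\<^sup>n\<^sup>-\<^sup>4\<^sup>)\<close> has an integral of order \<open>T\<^sup>4\<close> over the ball of radius \<open>T\<close>, what remains is of order
  \<open>T\<^sup>-\<^sup>a\<close> with \<open>a = (n - 4) / 2\<close>, and this tends to 0 as \<open>T\<close> grows. The argument is
  \<open>supersolution_zero_imp_zero\<close>.

  To have smooth test functions, the fundamental solution is replaced by \<open>(e + \<bar>x - z\<bar>\<^sup>2)\<^sup>-\<^sup>a\<close>, whose
  bilaplacian is exactly a positive multiple of \<open>e\<^sup>2 (e + \<bar>x - z\<bar>\<^sup>2)\<^sup>-\<^sup>a\<^sup>-\<^sup>4\<close>, a family that concentrates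
  at \<open>z\<close> as \<open>e\<close> tends to 0. The computation for the cut-off function is \<open>bilaplacian_prof\<close>, the integral
  of the weight is \<open>integral_rho_powr_le\<close>, the absorption is \<open>prof_absorb\<close>, and the limit \<open>e \<rightarrow> 0\<close> is
  \<open>integral_concentrating_le\<close>.

  The origin, where only continuity of \<open>v\<close> is known, is handled by \<open>Green_bilaplacian_puncture\<close>: a
  second cutoff that removes a ball of radius \<open>d\<close> costs \<open>d\<^sup>-\<^sup>4\<close> in the derivatives but only acts on a
  set of volume \<open>d\<^sup>n\<close>, and \<open>n \<ge> 5\<close>.
\<close>

section \<open>Calculus of partial derivatives\<close>

text \<open>
  The relational form of the partial derivative, which composes better than
  \<^const>\<open>has_partial_at\<close> and \<^const>\<open>partial_deriv\<close> separately.
\<close>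

definition has_pd :: "'n::finite \<Rightarrow> (real^'n \<Rightarrow> real) \<Rightarrow> real \<Rightarrow> real^'n \<Rightarrow> bool" where
  "has_pd j f D x \<longleftrightarrow> ((\<lambda>t. f (x + t *\<^sub>R axis j 1)) has_real_derivative D) (at 0)"

lemma has_pd_partial_deriv: "has_pd j f D x \<Longrightarrow> partial_deriv j f x = D"
  unfolding has_pd_def partial_deriv_def by (rule DERIV_imp_deriv)

lemma has_pd_has_partial_at: "has_pd j f D x \<Longrightarrow> has_partial_at j f x"
  unfolding has_pd_def has_partial_at_def field_differentiable_def by blast

lemma has_partial_at_has_pd: "has_partial_at j f x \<Longrightarrow> has_pd j f (partial_deriv j f x) x"
  unfolding has_pd_def partial_deriv_def has_partial_at_def
  using DERIV_deriv_iff_field_differentiable by blast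

lemma has_pd_const: "has_pd j (\<lambda>_. c) 0 x"
  unfolding has_pd_def by simp

lemma has_pd_coord: "has_pd j (\<lambda>x. x $ i) (if i = j then 1 else 0) x"
  unfolding has_pd_def by (auto intro!: derivative_eq_intros simp: axis_def)

lemma has_pd_add:
  "has_pd j f D x \<Longrightarrow> has_pd j g E x \<Longrightarrow> has_pd j (\<lambda>x. f x + g x) (D + E) x"
  unfolding has_pd_def by (rule DERIV_add)

lemma has_pd_mult:
  assumes "has_pd j f D x" "has_pd j g E x"
  shows "has_pd j (\<lambda>x. f x * g x) (D * g x + E * f x) x"
  using DERIV_mult[OF assms[unfolded has_pd_def]] unfolding has_pd_def by simp

lemma has_pd_chain:
  assumes "(h has_real_derivative E) (at (f x))" "has_pd j f D x"
  shows "has_pd j (\<lambda>x. h (f x)) (E * D) x"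
proof -
  have "(h has_real_derivative E) (at (f (x + 0 *\<^sub>R axis j 1)))" using assms(1) by simp
  from DERIV_chain2[OF this assms(2)[unfolded has_pd_def]] show ?thesis unfolding has_pd_def .
qed

lemma has_pd_sum:
  assumes "\<And>i. i \<in> I \<Longrightarrow> has_pd j (f i) (D i) x"
  shows "has_pd j (\<lambda>x. \<Sum>i\<in>I. f i x) (\<Sum>i\<in>I. D i) x"
  using assms unfolding has_pd_def by (intro DERIV_sum) auto

text \<open>
  Only the values of the function near \<open>x\<close> matter; this is what allows differentiation on an open
  set of functions that are arbitrary elsewhere.
\<close>

lemma has_pd_cong_open:
  assumes "open S" "x \<in> S" "\<And>y. y \<in> S \<Longrightarrow> f y = g y"
  shows "has_pd j f D x \<longleftrightarrow> has_pd j g D x"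
proof -
  have "continuous (at 0) (\<lambda>t. x + t *\<^sub>R axis j (1::real))" by (intro continuous_intros)
  hence "((\<lambda>t. x + t *\<^sub>R axis j (1::real)) \<longlongrightarrow> x) (at 0)" by (simp add: continuous_at)
  hence "eventually (\<lambda>t. x + t *\<^sub>R axis j (1::real) \<in> S) (at 0)"
    using assms topological_tendstoD by fastforce
  hence "eventually (\<lambda>t. x + t *\<^sub>R axis j (1::real) \<in> S) (nhds 0)"
    using assms(2) by (simp add: eventually_nhds_conv_at)
  hence "eventually (\<lambda>t. f (x + t *\<^sub>R axis j 1) = g (x + t *\<^sub>R axis j 1)) (nhds 0)"
    by (rule eventually_mono) (use assms in auto)
  thus ?thesis unfolding has_pd_def by (intro DERIV_cong_ev) auto
qed

lemma has_partial_at_iff: "has_partial_at j f x \<longleftrightarrow> (\<exists>D. has_pd j f D x)"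
  using has_pd_has_partial_at has_partial_at_has_pd by blast

lemma has_partial_at_cong_open:
  assumes "open S" "x \<in> S" "\<And>y. y \<in> S \<Longrightarrow> f y = g y"
  shows "has_partial_at j f x \<longleftrightarrow> has_partial_at j g x"
  unfolding has_partial_at_iff using assms by (metis has_pd_cong_open)

lemma partial_deriv_cong_open:
  assumes "open S" "x \<in> S" "\<And>y. y \<in> S \<Longrightarrow> f y = g y"
  shows "partial_deriv j f x = partial_deriv j g x"
proof -
  have "\<And>D. ((\<lambda>t. f (x + t *\<^sub>R axis j 1)) has_real_derivative D) (at 0) \<longleftrightarrow>
      ((\<lambda>t. g (x + t *\<^sub>R axis j 1)) has_real_derivative D) (at 0)"
    using has_pd_cong_open[OF assms(1,2), of f g] assms(3) unfolding has_pd_def by blast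
  thus ?thesis unfolding partial_deriv_def deriv_def by simp
qed

lemma Ck_on_cong:
  assumes "open S" "\<And>y. y \<in> S \<Longrightarrow> f y = g y"
  shows "Ck_on k S f \<longleftrightarrow> Ck_on k S g"
  using assms(2)
proof (induction k arbitrary: f g)
  case 0
  thus ?case by (auto cong: continuous_on_cong)
next
  case (Suc k)
  have "Ck_on k S (partial_deriv j f) \<longleftrightarrow> Ck_on k S (partial_deriv j g)" for j
    by (rule Suc.IH) (rule partial_deriv_cong_open[OF assms(1) _ Suc.prems])
  moreover have "continuous_on S f = continuous_on S g"
    using Suc.prems by (auto cong: continuous_on_cong)
  moreover have "has_partial_at j f x = has_partial_at j g x" if "x \<in> S" for j x
    by (rule has_partial_at_cong_open[OF assms(1) that Suc.prems])
  ultimately show ?case by simp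
qed

lemma Ck_on_continuous: "Ck_on k S f \<Longrightarrow> continuous_on S f"
  by (cases k) auto

lemma Ck_on_SucI:
  assumes "open S" "continuous_on S f" "\<And>j x. x \<in> S \<Longrightarrow> has_pd j f (D j x) x"
    "\<And>j. Ck_on k S (D j)"
  shows "Ck_on (Suc k) S f"
proof -
  have "Ck_on k S (partial_deriv j f)" for j
    using assms(4)[of j] Ck_on_cong[OF assms(1), of "partial_deriv j f" "D j" k]
      has_pd_partial_deriv[OF assms(3)] by blast
  thus ?thesis using assms by (auto intro: has_pd_has_partial_at)
qed

lemma Ck_on_SucD:
  assumes "Ck_on (Suc k) S f"
  shows "x \<in> S \<Longrightarrow> has_pd j f (partial_deriv j f x) x" "Ck_on k S (partial_deriv j f)"
  using assms by (auto intro: has_partial_at_has_pd)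

lemma Ck_on_Suc_imp: "Ck_on (Suc k) S f \<Longrightarrow> Ck_on k S f"
proof (induction k arbitrary: f)
  case (Suc k)
  have "Ck_on k S (partial_deriv j f)" for j using Suc by auto
  thus ?case using Suc.prems by auto
qed simp

lemma Ck_on_le: "l \<le> k \<Longrightarrow> Ck_on k S f \<Longrightarrow> Ck_on l S f"
  by (induction k rule: dec_induct) (auto dest: Ck_on_Suc_imp simp del: Ck_on.simps)

lemma Ck_on_subset: "T \<subseteq> S \<Longrightarrow> Ck_on k S f \<Longrightarrow> Ck_on k T f"
  by (induction k arbitrary: f) (auto intro: continuous_on_subset)

lemma Ck_on_const: "open S \<Longrightarrow> Ck_on k S (\<lambda>_. c)"
  by (induction k arbitrary: c)
     (auto intro!: Ck_on_SucI[where D = "\<lambda>_ _. 0"] has_pd_const simp del: Ck_on.simps(2))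

lemma Ck_on_coord: "open S \<Longrightarrow> Ck_on k S (\<lambda>x. x $ i)"
  by (cases k)
     (auto intro!: Ck_on_SucI[where D = "\<lambda>j _. if i = j then 1 else 0"] has_pd_coord Ck_on_const
       continuous_intros simp del: Ck_on.simps(2))

lemma Ck_on_add:
  "open S \<Longrightarrow> Ck_on k S f \<Longrightarrow> Ck_on k S g \<Longrightarrow> Ck_on k S (\<lambda>x. f x + g x)"
proof (induction k arbitrary: f g)
  case 0
  thus ?case by (auto intro: continuous_intros)
next
  case (Suc k)
  show ?case
  proof (rule Ck_on_SucI[where D = "\<lambda>j x. partial_deriv j f x + partial_deriv j g x"])
    show "continuous_on S (\<lambda>x. f x + g x)"
      using Suc.prems Ck_on_continuous by (intro continuous_intros) blast+
  qed (use Suc in \<open>auto intro!: has_pd_add Ck_on_SucD simp del: Ck_on.simps\<close>)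
qed

lemma Ck_on_sum:
  "open S \<Longrightarrow> (\<And>i. i \<in> I \<Longrightarrow> Ck_on k S (f i)) \<Longrightarrow> Ck_on k S (\<lambda>x. \<Sum>i\<in>I. f i x)"
  by (induction I rule: infinite_finite_induct) (auto intro: Ck_on_const Ck_on_add)

lemma Ck_on_mult:
  "open S \<Longrightarrow> Ck_on k S f \<Longrightarrow> Ck_on k S g \<Longrightarrow> Ck_on k S (\<lambda>x. f x * g x)"
proof (induction k arbitrary: f g)
  case 0
  thus ?case by (auto intro: continuous_intros)
next
  case (Suc k)
  show ?case
  proof (rule Ck_on_SucI[where D = "\<lambda>j x. partial_deriv j f x * g x + partial_deriv j g x * f x"])
    show "continuous_on S (\<lambda>x. f x * g x)"
      using Suc.prems Ck_on_continuous by (intro continuous_intros) blast+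
  qed (use Suc in \<open>auto intro!: has_pd_mult Ck_on_add Ck_on_SucD dest: Ck_on_Suc_imp simp del: Ck_on.simps\<close>)
qed

lemma Ck_on_cmult: "open S \<Longrightarrow> Ck_on k S f \<Longrightarrow> Ck_on k S (\<lambda>x. c * f x)"
  by (intro Ck_on_mult Ck_on_const)

lemma Ck_on_diff: "open S \<Longrightarrow> Ck_on k S f \<Longrightarrow> Ck_on k S g \<Longrightarrow> Ck_on k S (\<lambda>x. f x - g x)"
  using Ck_on_add[OF _ _ Ck_on_cmult[where c = "-1"], of S k f g] by simp

lemma norm_power2_vec: "(norm (x::real^'n))\<^sup>2 = (\<Sum>i\<in>UNIV. x $ i * x $ i)"
  unfolding power2_norm_eq_inner inner_vec_def by simp

lemma Ck_on_norm_power2: "Ck_on k UNIV (\<lambda>x::real^'n. (norm x)\<^sup>2)"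
  unfolding norm_power2_vec by (intro Ck_on_sum Ck_on_mult Ck_on_coord open_UNIV)

lemma Ck_on_powr:
  assumes "open S" "\<And>x. x \<in> S \<Longrightarrow> 0 < f x"
  shows "Ck_on k S f \<Longrightarrow> Ck_on k S (\<lambda>x. f x powr b)"
proof (induction k arbitrary: b)
  case 0
  thus ?case using assms by (auto intro!: continuous_intros dest!: assms(2))
next
  case (Suc k)
  show ?case
  proof (rule Ck_on_SucI[where D = "\<lambda>j x. b * f x powr (b - 1) * partial_deriv j f x"])
    show "continuous_on S (\<lambda>x. f x powr b)"
      using assms Suc.prems by (auto intro!: continuous_intros dest!: assms(2))
    show "has_pd j (\<lambda>x. f x powr b) (b * f x powr (b - 1) * partial_deriv j f x) x" if "x \<in> S" for j x
      using that assms Suc.prems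
      by (intro has_pd_chain Ck_on_SucD(1) has_real_derivative_powr) auto
    show "Ck_on k S (\<lambda>x. b * f x powr (b - 1) * partial_deriv j f x)" for j
      using Suc assms(1) by (intro Ck_on_mult Ck_on_const Ck_on_SucD(2) Suc.IH Ck_on_Suc_imp[OF Suc.prems])
  qed (rule assms)
qed

lemma DERIV_max_power:
  assumes "2 \<le> k"
  shows "((\<lambda>x::real. max 0 x ^ k) has_real_derivative real k * max 0 x ^ (k - 1)) (at x)"
proof -
  \<comment> \<open>Away from 0 the function is locally 0 or a power; at 0 the difference quotient is at most \<open>\<bar>h\<bar>\<close>.\<close>
  consider "x < 0" | "x > 0" | "x = 0" by linarith
  thus ?thesis
  proof cases
    case 1
    have "((\<lambda>x::real. max 0 x ^ k) has_real_derivative 0) (at x) \<longleftrightarrow> ((\<lambda>x::real. 0) has_real_derivative 0) (at x)"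
      using 1 assms eventually_nhds_in_open[of "{..<0}" x]
      by (intro DERIV_cong_ev) (auto elim!: eventually_mono simp: max_def zero_power)
    thus ?thesis using 1 assms by (auto simp: max_def zero_power)
  next
    case 2
    have "((\<lambda>x::real. max 0 x ^ k) has_real_derivative real k * x ^ (k - 1)) (at x) \<longleftrightarrow>
        ((\<lambda>x::real. x ^ k) has_real_derivative real k * x ^ (k - 1)) (at x)"
      using 2 eventually_nhds_in_open[of "{0<..}" x]
      by (intro DERIV_cong_ev) (auto elim!: eventually_mono simp: max_def)
    moreover have "((\<lambda>x::real. x ^ k) has_real_derivative real k * x ^ (k - 1)) (at x)"
      by (auto intro!: derivative_eq_intros)
    ultimately show ?thesis using 2 by (auto simp: max_def)
  next
    case 3
    have "((\<lambda>h. \<bar>h\<bar> :: real) \<longlongrightarrow> 0) (at 0)" by (auto intro!: tendsto_eq_intros)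
    hence "((\<lambda>h::real. max 0 h ^ k / h) \<longlongrightarrow> 0) (at 0)"
    proof (rule Lim_null_comparison[rotated])
      have "norm (max 0 h ^ k / h) \<le> \<bar>h\<bar>" if "\<bar>h\<bar> < 1" for h :: real
      proof (cases "h > 0")
        case True
        have "h ^ k \<le> h ^ 2" using True that assms by (intro power_decreasing) auto
        thus ?thesis using True by (simp add: max_def divide_simps power2_eq_square)
      qed (use assms in \<open>auto simp: max_def zero_power\<close>)
      thus "eventually (\<lambda>h::real. norm (max 0 h ^ k / h) \<le> \<bar>h\<bar>) (at 0)"
        by (auto simp: eventually_at dist_real_def intro!: exI[of _ 1])
    qed
    thus ?thesis using 3 assms by (simp add: DERIV_def zero_power)
  qed
qed

text \<open>
  Powers of positive parts supply all the cutoff functions below. Each derivative lowers the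
  exponent by one, so \<open>C\<^sup>4\<close> regularity needs an exponent of at least 5.
\<close>

lemma Ck_on_max_power:
  assumes "open S"
  shows "Ck_on k S f \<Longrightarrow> k < l \<Longrightarrow> Ck_on k S (\<lambda>x. max 0 (f x) ^ l)"
proof (induction k arbitrary: l)
  case 0
  thus ?case by (auto intro!: continuous_intros)
next
  case (Suc k)
  show ?case
  proof (rule Ck_on_SucI[where D = "\<lambda>j x. real l * max 0 (f x) ^ (l - 1) * partial_deriv j f x"])
    show "continuous_on S (\<lambda>x. max 0 (f x) ^ l)"
      using Suc.prems by (auto intro!: continuous_intros)
    show "has_pd j (\<lambda>x. max 0 (f x) ^ l) (real l * max 0 (f x) ^ (l - 1) * partial_deriv j f x) x"
      if "x \<in> S" for j x
      using Suc.prems that by (intro has_pd_chain Ck_on_SucD(1) DERIV_max_power) auto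
    show "Ck_on k S (\<lambda>x. real l * max 0 (f x) ^ (l - 1) * partial_deriv j f x)" for j
      using Suc assms by (intro Ck_on_mult Ck_on_const Ck_on_SucD(2) Suc.IH Ck_on_Suc_imp[OF Suc.prems(1)]) auto
  qed (rule assms)
qed

lemma Ck_on_Un:
  assumes "open S" "open T"
  shows "Ck_on k S f \<Longrightarrow> Ck_on k T f \<Longrightarrow> Ck_on k (S \<union> T) f"
  by (induction k arbitrary: f) (use assms in \<open>auto intro: continuous_on_open_Un\<close>)

lemma partial_deriv_add:
  assumes "Ck_on (Suc k) UNIV f" "Ck_on (Suc k) UNIV g"
  shows "partial_deriv j (\<lambda>x. f x + g x) = (\<lambda>x. partial_deriv j f x + partial_deriv j g x)"
  using assms by (intro ext has_pd_partial_deriv has_pd_add Ck_on_SucD(1)) auto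

lemma partial_deriv_mult:
  assumes "Ck_on (Suc k) UNIV f" "Ck_on (Suc k) UNIV g"
  shows "partial_deriv j (\<lambda>x. f x * g x) = (\<lambda>x. partial_deriv j f x * g x + partial_deriv j g x * f x)"
  using assms by (intro ext has_pd_partial_deriv has_pd_mult Ck_on_SucD(1)) auto

lemma laplacian_cong_open:
  assumes "open S" "x \<in> S" "\<And>y. y \<in> S \<Longrightarrow> f y = g y"
  shows "laplacian f x = laplacian g x"
  unfolding laplacian_def
  using assms by (intro sum.cong refl partial_deriv_cong_open[OF assms(1)]) auto

lemma Ck_on_laplacian: "open S \<Longrightarrow> Ck_on (Suc (Suc k)) S f \<Longrightarrow> Ck_on k S (laplacian f)"
proof -
  assume a: "open S" "Ck_on (Suc (Suc k)) S f"
  have "Ck_on k S (\<lambda>x. \<Sum>j\<in>UNIV. partial_deriv j (partial_deriv j f) x)"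
    using a by (intro Ck_on_sum Ck_on_SucD(2)) auto
  thus ?thesis by (simp add: laplacian_def [abs_def])
qed

lemma bilaplacian_cong_open:
  assumes "open S" "x \<in> S" "\<And>y. y \<in> S \<Longrightarrow> f y = g y"
  shows "laplacian (laplacian f) x = laplacian (laplacian g) x"
proof -
  have "laplacian f y = laplacian g y" if "y \<in> S" for y
    by (rule laplacian_cong_open[OF assms(1) that assms(3)])
  thus ?thesis by (rule laplacian_cong_open[OF assms(1,2)])
qed

lemma continuous_on_bilaplacian:
  "open S \<Longrightarrow> Ck_on 4 S f \<Longrightarrow> continuous_on S (laplacian (laplacian f))"
  using Ck_on_laplacian[of S 0 "laplacian f"] Ck_on_laplacian[of S 2 f] by (simp add: numeral_eq_Suc)

lemma laplacian_add:
  assumes "Ck_on 2 UNIV f" "Ck_on 2 UNIV g"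
  shows "laplacian (\<lambda>x. f x + g x) = (\<lambda>x. laplacian f x + laplacian g x)"
proof -
  have 2: "Ck_on (Suc 1) UNIV f" "Ck_on (Suc 1) UNIV g"
    using assms by (simp_all only: numeral_2_eq_2 One_nat_def)
  have 1: "Ck_on (Suc 0) UNIV (partial_deriv j f)" "Ck_on (Suc 0) UNIV (partial_deriv j g)" for j
    using Ck_on_SucD(2)[OF 2(1)] Ck_on_SucD(2)[OF 2(2)] by simp_all
  show ?thesis
    unfolding laplacian_def [abs_def] partial_deriv_add[OF 2] partial_deriv_add[OF 1]
    by (simp add: sum.distrib)
qed

lemma laplacian_cmult:
  assumes "Ck_on 2 UNIV f"
  shows "laplacian (\<lambda>x. c * f x) = (\<lambda>x. c * laplacian f x)"
proof -
  have 2: "Ck_on (Suc 1) UNIV f"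
    using assms by (simp_all only: numeral_2_eq_2 One_nat_def)
  have pd: "partial_deriv j (\<lambda>x. c * g x) = (\<lambda>x. c * partial_deriv j g x)"
    if "Ck_on (Suc k) UNIV g" for k j and g :: "real^'a \<Rightarrow> real"
    using has_pd_mult[OF has_pd_const Ck_on_SucD(1)[OF that]]
    by (intro ext has_pd_partial_deriv) (auto simp: mult.commute)
  have 1: "Ck_on (Suc 0) UNIV (partial_deriv j f)" for j
    using Ck_on_SucD(2)[OF 2] by simp
  show ?thesis
    unfolding laplacian_def [abs_def] pd[OF 2] pd[OF 1] by (simp add: sum_distrib_left)
qed

lemma laplacian_const: "laplacian (\<lambda>_. c) = (\<lambda>_. 0)"
proof -
  have "partial_deriv j (\<lambda>_. d) = (\<lambda>_. 0)" for j :: 'a and d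
    by (intro ext has_pd_partial_deriv has_pd_const)
  thus ?thesis by (simp add: laplacian_def [abs_def])
qed

lemma partial_deriv_outside:
  assumes "closed K" "\<And>x. x \<notin> K \<Longrightarrow> f x = 0" "x \<notin> K"
  shows "partial_deriv j f x = 0"
proof -
  have "partial_deriv j f x = partial_deriv j (\<lambda>_. 0) x"
    using assms by (intro partial_deriv_cong_open[of "- K"]) auto
  thus ?thesis using has_pd_partial_deriv[OF has_pd_const] by metis
qed

lemma laplacian_outside:
  assumes "closed K" "\<And>x. x \<notin> K \<Longrightarrow> f x = 0" "x \<notin> K"
  shows "laplacian f x = 0"
proof -
  have "partial_deriv j (partial_deriv j f) x = 0" for j
    by (rule partial_deriv_outside[OF assms(1) _ assms(3)]) (rule partial_deriv_outside[OF assms(1,2)])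
  thus ?thesis by (simp add: laplacian_def)
qed

section \<open>Integration by parts\<close>

text \<open>
  A test function supported in \<open>S\<close> extends the product by 0 to the whole space, whatever values
  \<open>v\<close> takes outside \<open>S\<close>.
\<close>

lemma Ck_on_mult_compact_support:
  assumes "open S" "compact K" "K \<subseteq> S" "Ck_on k S v" "Ck_on k UNIV \<phi>" "\<And>x. x \<notin> K \<Longrightarrow> \<phi> x = 0"
  shows "Ck_on k UNIV (\<lambda>x. v x * \<phi> x)"
proof -
  have op: "open (- K)" using assms(2) by (simp add: compact_imp_closed open_Compl)
  have "Ck_on k S (\<lambda>x. v x * \<phi> x)"
    using assms by (intro Ck_on_mult) (auto intro: Ck_on_subset[of S UNIV])
  moreover have "Ck_on k (- K) (\<lambda>x. v x * \<phi> x)"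
    using Ck_on_cong[OF op, of "\<lambda>x. v x * \<phi> x" "\<lambda>_. 0"] Ck_on_const[OF op] assms(6) by auto
  ultimately have "Ck_on k (S \<union> - K) (\<lambda>x. v x * \<phi> x)"
    by (rule Ck_on_Un[OF assms(1) op])
  moreover have "S \<union> - K = UNIV" using assms(3) by auto
  ultimately show ?thesis by simp
qed

lemma integrable_compact_support:
  fixes f :: "'a::euclidean_space \<Rightarrow> real"
  assumes "continuous_on UNIV f" "compact K" "\<And>x. x \<notin> K \<Longrightarrow> f x = 0"
  shows "integrable lborel f"
proof -
  have "integrable lborel (\<lambda>x. indicator K x *\<^sub>R f x)"
    using assms by (intro borel_integrable_compact) (auto intro: continuous_on_subset)
  moreover have "(\<lambda>x. indicator K x *\<^sub>R f x) = f"
    using assms(3) by (auto simp: indicator_def fun_eq_iff)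
  ultimately show ?thesis by simp
qed

lemma has_pd_shift:
  assumes "has_pd j f D (x + t *\<^sub>R axis j 1)"
  shows "((\<lambda>s. f (x + s *\<^sub>R axis j 1)) has_real_derivative D) (at t)"
proof -
  have "((\<lambda>s. f ((x + t *\<^sub>R axis j 1) + s *\<^sub>R axis j 1)) has_real_derivative D) (at 0)"
    using assms unfolding has_pd_def .
  hence "((\<lambda>s. f (x + (t + s) *\<^sub>R axis j 1)) has_real_derivative D) (at 0)"
    by (simp add: algebra_simps)
  thus ?thesis using DERIV_at_within_shift[of "\<lambda>s. f (x + s *\<^sub>R axis j 1)" D t 0 UNIV] by simp
qed

text \<open>
  The integral of a difference quotient of \<open>g\<close> vanishes by translation invariance. The quotients
  converge to the derivative, dominated by a bound for the derivative on a slightly larger ball.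
\<close>

lemma integral_partial_deriv_eq_0:
  fixes g :: "real^'n \<Rightarrow> real"
  assumes "Ck_on 1 UNIV g" "compact K" "\<And>x. x \<notin> K \<Longrightarrow> g x = 0"
  shows "integral\<^sup>L lborel (partial_deriv j g) = 0"
proof -
  define e :: "real^'n" where "e = axis j 1"
  have ne: "norm e = 1" by (simp add: e_def norm_axis_1)
  obtain R where R: "0 < R" "K \<subseteq> cball 0 R"
    using compact_imp_bounded[OF assms(2)] unfolding bounded_pos by (auto simp: subset_iff)
  have cg: "continuous_on UNIV g" and cd: "continuous_on UNIV (partial_deriv j g)"
    and pd: "\<And>x. has_pd j g (partial_deriv j g x) x"
    using assms(1) by (auto intro: has_partial_at_has_pd)
  have d0: "partial_deriv j g x = 0" if "x \<notin> K" for x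
    using partial_deriv_outside[OF compact_imp_closed[OF assms(2)] assms(3) that] .
  have "compact (partial_deriv j g ` K)"
    using assms(2) cd by (intro compact_continuous_image) (auto intro: continuous_on_subset)
  then obtain M0 where "\<And>x. x \<in> K \<Longrightarrow> \<bar>partial_deriv j g x\<bar> \<le> M0"
    using compact_imp_bounded[of "partial_deriv j g ` K"] unfolding bounded_iff by auto
  hence M: "\<bar>partial_deriv j g x\<bar> \<le> max 0 M0" for x
    using d0[of x] by (cases "x \<in> K") force+
  define M where "M = max 0 M0"
  define h where "h k x = (g (x + (1 / real (Suc k)) *\<^sub>R e) - g x) * real (Suc k)" for k x
  have ig: "integrable lborel g" by (rule integrable_compact_support[OF cg assms(2,3)])
  have tr: "integrable lborel (\<lambda>x. g (x + c)) \<and> (\<integral>x. g (x + c) \<partial>lborel) = (\<integral>x. g x \<partial>lborel)" for c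
  proof -
    have m: "g \<in> borel_measurable borel" using cg by (rule borel_measurable_continuous_onI)
    have eq: "(\<integral>x. g x \<partial>lborel) = (\<integral>x. g x \<partial>(distr lborel borel ((+) c)))"
      by (simp add: lborel_distr_plus)
    have "integrable lborel g \<longleftrightarrow> integrable (distr lborel borel ((+) c)) g"
      by (simp add: lborel_distr_plus)
    hence "integrable lborel (\<lambda>x. g (c + x))" using ig m by (subst (asm) integrable_distr_eq) auto
    moreover have "(\<integral>x. g x \<partial>(distr lborel borel ((+) c))) = (\<integral>x. g (c + x) \<partial>lborel)"
      using m by (subst integral_distr) auto
    ultimately show ?thesis using eq by (simp add: add.commute)
  qed
  have h0: "(\<integral>x. h k x \<partial>lborel) = 0" for k
    unfolding h_def using tr ig by simp
  have hb: "norm (h k x) \<le> M * indicator (cball 0 (R + 1)) x" for k x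
  proof -
    define s where "s = 1 / real (Suc k)"
    have s: "0 < s" "s \<le> 1" by (auto simp: s_def)
    have "\<exists>z>0. z < s \<and> g (x + s *\<^sub>R e) - g (x + 0 *\<^sub>R e) = (s - 0) * partial_deriv j g (x + z *\<^sub>R e)"
      using s pd unfolding e_def by (intro MVT2 has_pd_shift) auto
    then obtain z where z: "g (x + s *\<^sub>R e) - g x = s * partial_deriv j g (x + z *\<^sub>R e)" by auto
    \<comment> \<open>The mean value theorem turns the difference quotient into a derivative at an intermediate point.\<close>
    have eq: "h k x = partial_deriv j g (x + z *\<^sub>R e)"
      using z s by (simp add: h_def s_def)
    show ?thesis
    proof (cases "x \<in> cball 0 (R + 1)")
      case True
      thus ?thesis using eq M by (simp add: M_def)
    next
      case False
      have "norm (s *\<^sub>R e) \<le> 1" using s ne by simp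
      hence "norm (x + s *\<^sub>R e) > R"
        using False norm_triangle_ineq[of "x + s *\<^sub>R e" "- (s *\<^sub>R e)"] by simp
      hence "x + s *\<^sub>R e \<notin> K" "x \<notin> K" using R False by auto
      hence "h k x = 0" using assms(3) by (simp add: h_def s_def)
      thus ?thesis using False by simp
    qed
  qed
  have lim: "(\<lambda>k. h k x) \<longlonglongrightarrow> partial_deriv j g x" for x
  proof -
    have "((\<lambda>t. (g (x + t *\<^sub>R e) - g x) / t) \<longlongrightarrow> partial_deriv j g x) (at 0)"
      using pd[of x] unfolding has_pd_def DERIV_def e_def by simp
    moreover have "filterlim (\<lambda>k. 1 / real (Suc k)) (at 0) sequentially"
      unfolding filterlim_at using LIMSEQ_inverse_real_of_nat by (auto simp: inverse_eq_divide)
    ultimately have "(\<lambda>k. (g (x + (1 / real (Suc k)) *\<^sub>R e) - g x) / (1 / real (Suc k))) \<longlonglongrightarrow> partial_deriv j g x"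
      by (rule filterlim_compose)
    thus ?thesis by (simp add: h_def)
  qed
  have "(\<lambda>k. \<integral>x. h k x \<partial>lborel) \<longlonglongrightarrow> (\<integral>x. partial_deriv j g x \<partial>lborel)"
  proof (rule integral_dominated_convergence[where w = "\<lambda>x. M * indicator (cball 0 (R + 1)) x"])
    show "partial_deriv j g \<in> borel_measurable lborel"
      using borel_measurable_continuous_onI[OF cd] by simp
    have m[measurable]: "g \<in> borel_measurable borel" using cg by (rule borel_measurable_continuous_onI)
    show "h k \<in> borel_measurable lborel" for k
      unfolding h_def by measurable
    have "emeasure lborel (cball (0::real^'n) (R + 1)) < \<infinity>"
      using emeasure_bounded_finite[of "cball (0::real^'n) (R+1)"] by simp
    thus "integrable lborel (\<lambda>x. M * indicator (cball (0::real^'n) (R + 1)) x)"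
      by (intro integrable_mult_right integrable_real_indicator) auto
  qed (use lim hb in auto)
  thus ?thesis unfolding h0 by (simp add: LIMSEQ_const_iff)
qed

context
  fixes S K :: "(real^'n) set"
  assumes S: "open S" and K: "compact K" "K \<subseteq> S"
begin

lemma integrable_mult_compact_support:
  assumes "continuous_on S v" "continuous_on UNIV (\<phi> :: _ \<Rightarrow> real)" "\<And>x. x \<notin> K \<Longrightarrow> \<phi> x = 0"
  shows "integrable lborel (\<lambda>x. v x * \<phi> x :: real)"
proof (rule integrable_compact_support[OF _ K(1)])
  show "continuous_on UNIV (\<lambda>x. v x * \<phi> x)"
    using Ck_on_mult_compact_support[OF S K, of 0 v \<phi>] assms by simp
qed (simp add: assms(3))

lemma integration_by_parts:
  assumes v: "Ck_on 1 S v" and p: "Ck_on 1 UNIV \<phi>" "\<And>x. x \<notin> K \<Longrightarrow> \<phi> x = 0"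
  shows "(\<integral>x. partial_deriv j v x * \<phi> x \<partial>lborel) = - (\<integral>x. v x * partial_deriv j \<phi> x \<partial>lborel)"
proof -
  have K': "closed K" using K by (simp add: compact_imp_closed)
  have p0: "partial_deriv j \<phi> x = 0" if "x \<notin> K" for x
    using partial_deriv_outside[OF K' p(2) that] .
  have eq: "partial_deriv j (\<lambda>x. v x * \<phi> x) x = partial_deriv j v x * \<phi> x + v x * partial_deriv j \<phi> x" for x
  proof (cases "x \<in> S")
    case True
    have "has_pd j (\<lambda>x. v x * \<phi> x) (partial_deriv j v x * \<phi> x + partial_deriv j \<phi> x * v x) x"
      using v p True by (intro has_pd_mult) (auto intro: has_partial_at_has_pd)
    from has_pd_partial_deriv[OF this] show ?thesis by simp
  next
    case False
    hence "x \<notin> K" using K by auto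
    moreover from this have "partial_deriv j (\<lambda>x. v x * \<phi> x) x = 0"
      by (rule partial_deriv_outside[OF K', rotated]) (simp add: p)
    ultimately show ?thesis using p p0 by simp
  qed
  have "0 = (\<integral>x. partial_deriv j (\<lambda>x. v x * \<phi> x) x \<partial>lborel)"
    using integral_partial_deriv_eq_0[OF Ck_on_mult_compact_support[OF S K v p] K(1)] p(2)
    by simp
  also have "\<dots> = (\<integral>x. partial_deriv j v x * \<phi> x \<partial>lborel) + (\<integral>x. v x * partial_deriv j \<phi> x \<partial>lborel)"
    unfolding eq using v p p0
    by (intro Bochner_Integration.integral_add integrable_mult_compact_support) auto
  finally show ?thesis by simp
qed

lemma Green_laplacian:
  assumes v: "Ck_on 2 S v" and p: "Ck_on 2 UNIV \<phi>" "\<And>x. x \<notin> K \<Longrightarrow> \<phi> x = 0"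
  shows "(\<integral>x. laplacian v x * \<phi> x \<partial>lborel) = (\<integral>x. v x * laplacian \<phi> x \<partial>lborel)"
proof -
  have K': "closed K" using K by (simp add: compact_imp_closed)
  have v': "Ck_on (Suc 1) S v" and p': "Ck_on (Suc 1) UNIV \<phi>"
    using v p(1) by (simp_all only: numeral_2_eq_2 One_nat_def)
  note p0 = partial_deriv_outside[OF K' p(2)]
  note p00 = partial_deriv_outside[OF K' p0]
  have cont: "continuous_on S (partial_deriv j (partial_deriv j v))" "continuous_on UNIV \<phi>"
     "continuous_on UNIV (partial_deriv j (partial_deriv j \<phi>))" "continuous_on S v" for j
    using v p(1) by (auto simp: numeral_2_eq_2)
  have "(\<integral>x. laplacian v x * \<phi> x \<partial>lborel) = (\<Sum>j\<in>UNIV. \<integral>x. partial_deriv j (partial_deriv j v) x * \<phi> x \<partial>lborel)"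
    unfolding laplacian_def sum_distrib_right
    by (intro Bochner_Integration.integral_sum integrable_mult_compact_support cont p)
  also have "\<dots> = (\<Sum>j\<in>UNIV. \<integral>x. v x * partial_deriv j (partial_deriv j \<phi>) x \<partial>lborel)"
  proof (intro sum.cong refl)
    fix j
    show "(\<integral>x. partial_deriv j (partial_deriv j v) x * \<phi> x \<partial>lborel) =
        (\<integral>x. v x * partial_deriv j (partial_deriv j \<phi>) x \<partial>lborel)"
      using integration_by_parts[OF Ck_on_SucD(2)[OF v'] Ck_on_Suc_imp[OF p'] p(2), of j j]
        integration_by_parts[OF Ck_on_Suc_imp[OF v'] Ck_on_SucD(2)[OF p'], of j j] p0 by simp
  qed
  also have "\<dots> = (\<integral>x. v x * laplacian \<phi> x \<partial>lborel)"
    unfolding laplacian_def sum_distrib_left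
    by (intro Bochner_Integration.integral_sum [symmetric] integrable_mult_compact_support cont p00)
  finally show ?thesis .
qed

lemma Green_bilaplacian:
  assumes v: "Ck_on 4 S v" and p: "Ck_on 4 UNIV \<phi>" "\<And>x. x \<notin> K \<Longrightarrow> \<phi> x = 0"
  shows "(\<integral>x. laplacian (laplacian v) x * \<phi> x \<partial>lborel) = (\<integral>x. v x * laplacian (laplacian \<phi>) x \<partial>lborel)"
proof -
  have K': "closed K" using K by (simp add: compact_imp_closed)
  have v': "Ck_on (Suc (Suc 2)) S v" and p': "Ck_on (Suc (Suc 2)) UNIV \<phi>"
    using v p(1) by (simp_all add: numeral_eq_Suc)
  have "(\<integral>x. laplacian (laplacian v) x * \<phi> x \<partial>lborel) = (\<integral>x. laplacian v x * laplacian \<phi> x \<partial>lborel)"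
    using Ck_on_le[OF _ p(1), of 2] p(2) by (intro Green_laplacian Ck_on_laplacian S v') auto
  also have "\<dots> = (\<integral>x. v x * laplacian (laplacian \<phi>) x \<partial>lborel)"
    using Ck_on_le[OF _ v, of 2] laplacian_outside[OF K' p(2)]
    by (intro Green_laplacian Ck_on_laplacian p') auto
  finally show ?thesis .
qed

end

lemma integral_bilaplacian_eq_0:
  assumes "Ck_on 4 UNIV \<phi>" "compact K" "\<And>x. x \<notin> K \<Longrightarrow> \<phi> x = 0"
  shows "(\<integral>x. laplacian (laplacian \<phi>) x \<partial>lborel) = 0"
  using Green_bilaplacian[OF open_UNIV assms(2) _ Ck_on_const[OF open_UNIV, of 4 1] assms(1,3)]
  by (simp add: laplacian_const)

section \<open>Scale-dependent bounds on derivatives\<close>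

text \<open>
  A function with this property varies on the length scale \<open>d\<close>: its derivatives of order \<open>i \<le> k\<close> are
  bounded on \<open>S\<close> by \<open>M / d\<^sup>i\<close>. In this form the bounds are stable under products and rescaling.
\<close>

primrec dbound :: "nat \<Rightarrow> (real^'n::finite) set \<Rightarrow> real \<Rightarrow> real \<Rightarrow> (real^'n \<Rightarrow> real) \<Rightarrow> bool" where
  "dbound 0 S d M f \<longleftrightarrow> (\<forall>x\<in>S. \<bar>f x\<bar> \<le> M)"
| "dbound (Suc k) S d M f \<longleftrightarrow> (\<forall>x\<in>S. \<bar>f x\<bar> \<le> M) \<and> (\<forall>j. dbound k S d (M / d) (partial_deriv j f))"

lemma dbound_Suc_imp: "dbound (Suc k) S d M f \<Longrightarrow> dbound k S d M f"
proof (induction k arbitrary: f M)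
  case (Suc k)
  have "dbound k S d (M / d) (partial_deriv j f)" for j using Suc by auto
  thus ?case using Suc.prems by auto
qed simp

lemma dbound_bound: "dbound k S d M f \<Longrightarrow> x \<in> S \<Longrightarrow> \<bar>f x\<bar> \<le> M"
  by (cases k) auto

lemma dbound_subset: "T \<subseteq> S \<Longrightarrow> dbound k S d M f \<Longrightarrow> dbound k T d M f"
  by (induction k arbitrary: f M) auto

lemma dbound_mono: "0 < d \<Longrightarrow> M \<le> N \<Longrightarrow> dbound k S d M f \<Longrightarrow> dbound k S d N f"
proof (induction k arbitrary: f M N)
  case (Suc k)
  have "dbound k S d (N / d) (partial_deriv j f)" for j
    by (rule Suc.IH[of "M / d"]) (use Suc.prems in \<open>auto intro: divide_right_mono\<close>)
  moreover have "\<bar>f x\<bar> \<le> N" if "x \<in> S" for x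
    using dbound_bound[OF Suc.prems(3) that] Suc.prems(2) by linarith
  ultimately show ?case by simp
qed (meson dbound.simps(1) order_trans)

lemma dbound_smaller_scale:
  "0 < d \<Longrightarrow> d \<le> 1 \<Longrightarrow> 0 \<le> M \<Longrightarrow> dbound k S 1 M f \<Longrightarrow> dbound k S d M f"
proof (induction k arbitrary: f M)
  case (Suc k)
  have "dbound k S d (M / d) (partial_deriv j f)" for j
  proof (rule dbound_mono)
    show "dbound k S d M (partial_deriv j f)" using Suc by auto
    show "M \<le> M / d" using Suc.prems by (simp add: field_simps mult_left_le)
  qed (use Suc.prems in auto)
  thus ?case using Suc.prems by auto
qed simp

lemma dbound_add:
  "0 < d \<Longrightarrow> Ck_on k UNIV f \<Longrightarrow> Ck_on k UNIV g \<Longrightarrow> dbound k S d M f \<Longrightarrow> dbound k S d N g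
    \<Longrightarrow> dbound k S d (M + N) (\<lambda>x. f x + g x)"
proof (induction k arbitrary: f g M N)
  case 0
  show ?case
    unfolding dbound.simps
  proof
    fix x assume "x \<in> S"
    thus "\<bar>f x + g x\<bar> \<le> M + N" using 0(4,5) abs_triangle_ineq[of "f x" "g x"] by fastforce
  qed
next
  case (Suc k)
  have "dbound k S d ((M + N) / d) (partial_deriv j (\<lambda>x. f x + g x))" for j
    unfolding partial_deriv_add[OF Suc.prems(2,3)] add_divide_distrib
    using Suc.prems by (intro Suc.IH) auto
  moreover have "\<bar>f x + g x\<bar> \<le> M + N" if "x \<in> S" for x
    using Suc.prems that by (intro order_trans[OF abs_triangle_ineq] add_mono) auto
  ultimately show ?case by simp
qed

lemma dbound_sum:
  fixes f :: "'i \<Rightarrow> real^'n \<Rightarrow> real"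
  assumes "0 < d" "finite I" "\<And>i. i \<in> I \<Longrightarrow> Ck_on k UNIV (f i)" "\<And>i. i \<in> I \<Longrightarrow> dbound k S d M (f i)"
  shows "dbound k S d (real (card I) * M) (\<lambda>x. \<Sum>i\<in>I. f i x)"
  using assms(2-)
proof (induction I rule: finite_induct)
  case empty
  have 0: "partial_deriv j (\<lambda>x. 0) = (\<lambda>x::real^'n. 0)" for j
    by (intro ext has_pd_partial_deriv has_pd_const)
  have "dbound k S d 0 (\<lambda>x. 0)" by (induction k) (auto simp: 0)
  thus ?case by simp
next
  case (insert i I)
  have "dbound k S d (M + real (card I) * M) (\<lambda>x. f i x + (\<Sum>i\<in>I. f i x))"
  proof (rule dbound_add[OF assms(1)])
    show "Ck_on k UNIV (\<lambda>x. \<Sum>i\<in>I. f i x)"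
      using insert.prems by (intro Ck_on_sum) auto
  qed (use insert in auto)
  thus ?case using insert by (simp add: algebra_simps)
qed

text \<open>
  By the Leibniz rule the number of terms doubles with each derivative.
\<close>

lemma dbound_mult:
  "0 < d \<Longrightarrow> Ck_on k UNIV f \<Longrightarrow> Ck_on k UNIV g \<Longrightarrow> 0 \<le> M \<Longrightarrow> 0 \<le> N \<Longrightarrow>
    dbound k S d M f \<Longrightarrow> dbound k S d N g \<Longrightarrow> dbound k S d (2 ^ k * M * N) (\<lambda>x. f x * g x)"
proof (induction k arbitrary: f g M N)
  case 0
  thus ?case by (auto simp: abs_mult intro!: mult_mono)
next
  case (Suc k)
  have "dbound k S d (2 ^ k * (M / d) * N + 2 ^ k * (N / d) * M)
      (\<lambda>x. partial_deriv j f x * g x + partial_deriv j g x * f x)" for j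
  proof (rule dbound_add[OF Suc.prems(1)])
    note f = Ck_on_SucD(2)[OF Suc.prems(2), of j] Ck_on_Suc_imp[OF Suc.prems(2)]
      and g = Ck_on_SucD(2)[OF Suc.prems(3), of j] Ck_on_Suc_imp[OF Suc.prems(3)]
    show "Ck_on k UNIV (\<lambda>x. partial_deriv j f x * g x)"
      "Ck_on k UNIV (\<lambda>x. partial_deriv j g x * f x)"
      using f g by (auto intro: Ck_on_mult)
    have "dbound k S d (M / d) (partial_deriv j f)" "dbound k S d (N / d) (partial_deriv j g)"
      using Suc.prems by auto
    thus "dbound k S d (2 ^ k * (M / d) * N) (\<lambda>x. partial_deriv j f x * g x)"
      "dbound k S d (2 ^ k * (N / d) * M) (\<lambda>x. partial_deriv j g x * f x)"
      using Suc.IH[OF Suc.prems(1) f(1) g(2) _ Suc.prems(5) _ dbound_Suc_imp[OF Suc.prems(7)], of "M / d"]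
        Suc.IH[OF Suc.prems(1) g(1) f(2) _ Suc.prems(4) _ dbound_Suc_imp[OF Suc.prems(6)], of "N / d"]
        Suc.prems(1,4,5) by simp_all
  qed
  moreover have "2 ^ k * (M / d) * N + 2 ^ k * (N / d) * M = 2 ^ Suc k * M * N / d"
    by (simp add: field_simps)
  ultimately have "dbound k S d (2 ^ Suc k * M * N / d) (partial_deriv j (\<lambda>x. f x * g x))" for j
    unfolding partial_deriv_mult[OF Suc.prems(2,3)] by metis
  moreover have "\<bar>f x * g x\<bar> \<le> 2 ^ Suc k * M * N" if "x \<in> S" for x
  proof -
    have "\<bar>f x * g x\<bar> \<le> 1 * (M * N)"
      using Suc.prems that by (auto simp: abs_mult intro!: mult_mono)
    also have "\<dots> \<le> 2 ^ Suc k * (M * N)"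
      using Suc.prems one_le_power[of "2::real" "Suc k"] by (intro mult_right_mono) auto
    finally show ?thesis by (simp only: mult.assoc)
  qed
  ultimately show ?case by simp
qed

lemma has_pd_scaled:
  assumes "has_pd j f D ((1 / d) *\<^sub>R x)" "0 < d"
  shows "has_pd j (\<lambda>x. c * f ((1 / d) *\<^sub>R x)) (c / d * D) x"
proof -
  have "((\<lambda>t. f ((1 / d) *\<^sub>R x + t *\<^sub>R axis j 1)) has_real_derivative D) (at (0 / d))"
    (is "?H") using assms unfolding has_pd_def by simp
  have "((\<lambda>t. f ((1 / d) *\<^sub>R x + (t / d) *\<^sub>R axis j 1)) has_real_derivative D * (1 / d)) (at 0)"
    by (rule DERIV_chain2[where f = "\<lambda>t. f ((1 / d) *\<^sub>R x + t *\<^sub>R axis j 1)" and g = "\<lambda>t. t / d", OF \<open>?H\<close>])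
       (use assms in \<open>auto intro!: derivative_eq_intros\<close>)
  from DERIV_cmult[OF this, of c] show ?thesis
    unfolding has_pd_def by (simp add: scaleR_add_right)
qed

lemma Ck_on_scaled:
  assumes "0 < d"
  shows "Ck_on k UNIV f \<Longrightarrow> Ck_on k UNIV (\<lambda>x. c * f ((1 / d) *\<^sub>R x))"
proof (induction k arbitrary: c f)
  case 0
  thus ?case by (auto intro!: continuous_intros continuous_on_compose2[of UNIV f])
next
  case (Suc k)
  show ?case
  proof (rule Ck_on_SucI[where D = "\<lambda>j x. c / d * partial_deriv j f ((1 / d) *\<^sub>R x)"])
    show "continuous_on UNIV (\<lambda>x. c * f ((1 / d) *\<^sub>R x))"
      using Ck_on_continuous[OF Suc.prems]
      by (auto intro!: continuous_intros continuous_on_compose2[of UNIV f])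
    show "has_pd j (\<lambda>x. c * f ((1 / d) *\<^sub>R x)) (c / d * partial_deriv j f ((1 / d) *\<^sub>R x)) x" for j x
      using Suc.prems assms by (intro has_pd_scaled Ck_on_SucD(1)) auto
    show "Ck_on k UNIV (\<lambda>x. c / d * partial_deriv j f ((1 / d) *\<^sub>R x))" for j
      using Suc.prems by (intro Suc.IH Ck_on_SucD(2))
  qed simp
qed

lemma dbound_scaled:
  assumes "0 < d"
  shows "Ck_on k UNIV f \<Longrightarrow> 0 \<le> c \<Longrightarrow> dbound k ((*\<^sub>R) (1 / d) ` S) 1 M f \<Longrightarrow>
    dbound k S d (c * M) (\<lambda>x. c * f ((1 / d) *\<^sub>R x))"
proof (induction k arbitrary: c f M)
  case 0
  thus ?case by (auto simp: abs_mult intro!: mult_left_mono)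
next
  case (Suc k)
  have "partial_deriv j (\<lambda>x. c * f ((1 / d) *\<^sub>R x)) = (\<lambda>x. (c / d) * partial_deriv j f ((1 / d) *\<^sub>R x))" for j
    using Suc.prems assms by (intro ext has_pd_partial_deriv has_pd_scaled Ck_on_SucD(1)) auto
  moreover have "dbound k S d ((c / d) * M) (\<lambda>x. (c / d) * partial_deriv j f ((1 / d) *\<^sub>R x))" for j
    using Suc.prems assms by (intro Suc.IH) auto
  moreover have "\<bar>c * f ((1 / d) *\<^sub>R x)\<bar> \<le> c * M" if "x \<in> S" for x
    using Suc.prems that by (auto simp: abs_mult intro!: mult_left_mono)
  ultimately show ?case by simp
qed

lemma Ck_on_imp_dbound:
  assumes "compact S"
  shows "Ck_on k UNIV f \<Longrightarrow> \<exists>M\<ge>0. dbound k S 1 M f"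
proof (induction k arbitrary: f)
  case 0
  have "compact (f ` S)"
    using 0 assms by (intro compact_continuous_image) (auto intro: continuous_on_subset)
  then obtain M where "\<forall>x\<in>S. \<bar>f x\<bar> \<le> M"
    using compact_imp_bounded[of "f ` S"] unfolding bounded_iff by auto
  thus ?case by (intro exI[of _ "max 0 M"]) auto
next
  case (Suc k)
  have "compact (f ` S)"
    using Ck_on_continuous[OF Suc.prems] assms
    by (intro compact_continuous_image) (auto intro: continuous_on_subset)
  then obtain M where M: "\<forall>x\<in>S. \<bar>f x\<bar> \<le> M"
    using compact_imp_bounded[of "f ` S"] unfolding bounded_iff by auto
  have "\<forall>j. \<exists>M\<ge>0. dbound k S 1 M (partial_deriv j f)"
    using Suc by auto
  then obtain N where N: "\<And>j. 0 \<le> N j" "\<And>j. dbound k S 1 (N j) (partial_deriv j f)" by metis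
  have "N j \<le> (\<Sum>j\<in>UNIV. N j)" for j
    by (rule member_le_sum) (use N in auto)
  hence "dbound k S 1 (max 0 M + (\<Sum>j\<in>UNIV. N j)) (partial_deriv j f)" for j
    using N(1) by (intro dbound_mono[OF _ _ N(2)]) (auto intro: add_increasing)
  moreover have "\<bar>f x\<bar> \<le> max 0 M + (\<Sum>j\<in>UNIV. N j)" if "x \<in> S" for x
    using M that sum_nonneg[of UNIV N] N(1) by fastforce
  ultimately show ?case
    using N(1) by (intro exI[of _ "max 0 M + (\<Sum>j\<in>UNIV. N j)"]) (auto intro!: add_nonneg_nonneg sum_nonneg)
qed

lemma dbound_laplacian:
  fixes f :: "real^'n \<Rightarrow> real"
  assumes "0 < d" "Ck_on (Suc (Suc k)) UNIV f" "dbound (Suc (Suc k)) S d M f"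
  shows "dbound k S d (real CARD('n) * (M / d\<^sup>2)) (laplacian f)"
proof -
  have "dbound k S d (real (card (UNIV :: 'n set)) * (M / d / d)) (\<lambda>x. \<Sum>j\<in>UNIV. partial_deriv j (partial_deriv j f) x)"
    using assms by (intro dbound_sum) auto
  thus ?thesis by (simp add: laplacian_def [abs_def] power2_eq_square)
qed

lemma dbound_bilaplacian:
  fixes f :: "real^'n \<Rightarrow> real"
  assumes "0 < d" "Ck_on 4 UNIV f" "dbound 4 S d M f" "x \<in> S"
  shows "\<bar>laplacian (laplacian f) x\<bar> \<le> (real CARD('n))\<^sup>2 * M / d ^ 4"
proof -
  have 1: "dbound 2 S d (real CARD('n) * (M / d\<^sup>2)) (laplacian f)"
    using assms by (intro dbound_laplacian) (simp_all only: numeral_eq_Suc pred_numeral_simps Suc_eq_plus1 BitM.simps)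
  have "Ck_on 2 UNIV (laplacian f)"
    using assms by (intro Ck_on_laplacian) (simp_all add: numeral_eq_Suc)
  hence "dbound 0 S d (real CARD('n) * (real CARD('n) * (M / d\<^sup>2) / d\<^sup>2)) (laplacian (laplacian f))"
    using 1 assms(1) by (rule_tac dbound_laplacian) (simp_all only: numeral_2_eq_2)
  hence "\<bar>laplacian (laplacian f) x\<bar> \<le> real CARD('n) * (real CARD('n) * (M / d\<^sup>2) / d\<^sup>2)"
    using assms(4) by simp
  also have "\<dots> = (real CARD('n))\<^sup>2 * M / d ^ 4"
    by (simp add: power2_eq_square power4_eq_xxxx)
  finally show ?thesis .
qed

section \<open>Removing the puncture\<close>

text \<open>
  A \<open>C\<^sup>4\<close> function that vanishes on the unit ball and equals 1 outside the ball of radius 2. The inner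
  power makes it vanish on a whole neighbourhood of the origin, the outer one makes it constant far out.
\<close>

definition puncture_cutoff :: "real^'n::finite \<Rightarrow> real" where
  "puncture_cutoff x = 1 - max 0 (1 - max 0 ((norm x)\<^sup>2 - 1) ^ 5) ^ 5"

lemma Ck_on_puncture_cutoff: "Ck_on 4 UNIV (puncture_cutoff :: real^'n::finite \<Rightarrow> real)"
  unfolding puncture_cutoff_def [abs_def]
  by (intro Ck_on_diff Ck_on_max_power Ck_on_const Ck_on_norm_power2 open_UNIV) auto

lemma puncture_cutoff_eq_0: "norm x \<le> 1 \<Longrightarrow> puncture_cutoff x = 0"
  by (simp add: puncture_cutoff_def power_le_one)

lemma puncture_cutoff_eq_1: "2 \<le> norm x \<Longrightarrow> puncture_cutoff x = 1"
proof -
  assume "2 \<le> norm x"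
  hence "2 * 2 \<le> (norm x)\<^sup>2" unfolding power2_eq_square by (intro mult_mono) auto
  hence "1 \<le> max 0 ((norm x)\<^sup>2 - 1)" by auto
  hence "1 \<le> max 0 ((norm x)\<^sup>2 - 1) ^ 5" by (rule one_le_power)
  thus ?thesis by (simp add: puncture_cutoff_def)
qed

lemma puncture_cutoff_bounds: "0 \<le> puncture_cutoff x" "puncture_cutoff x \<le> 1"
  by (auto simp: puncture_cutoff_def intro!: power_le_one)

lemma abs_integral_le_content:
  fixes f :: "'a::euclidean_space \<Rightarrow> real"
  assumes "integrable lborel f" "\<And>x. \<bar>f x\<bar> \<le> c * indicator (cball 0 r) x"
  shows "\<bar>integral\<^sup>L lborel f\<bar> \<le> c * measure lborel (cball (0::'a) r)"
proof -
  have fin: "emeasure lborel (cball (0::'a) r) < \<infinity>"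
    using emeasure_bounded_finite[of "cball (0::'a) r"] by simp
  have "\<bar>integral\<^sup>L lborel f\<bar> \<le> (\<integral>x. \<bar>f x\<bar> \<partial>lborel)"
    using integral_norm_bound[of lborel f] by simp
  also have "\<dots> \<le> (\<integral>x. c * indicator (cball (0::'a) r) x \<partial>lborel)"
  proof (rule Bochner_Integration.integral_mono)
    show "integrable lborel (\<lambda>x. c * indicator (cball (0::'a) r) x)"
      using fin by (intro integrable_mult_right integrable_real_indicator) auto
  qed (use assms in auto)
  also have "\<dots> = c * measure lborel (cball (0::'a) r)"
    by simp
  finally show ?thesis .
qed

lemma bounded_on_compact:
  fixes f :: "'a::topological_space \<Rightarrow> real"
  assumes "continuous_on UNIV f" "compact S"
  obtains B where "0 \<le> B" "\<And>x. x \<in> S \<Longrightarrow> \<bar>f x\<bar> \<le> B"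
proof -
  have "compact (f ` S)"
    using assms by (intro compact_continuous_image) (auto intro: continuous_on_subset)
  then obtain M where "\<forall>x\<in>S. \<bar>f x\<bar> \<le> M"
    using compact_imp_bounded[of "f ` S"] unfolding bounded_iff by auto
  thus ?thesis by (intro that[of "max 0 M"]) auto
qed

text \<open>
  A continuous function whose bilaplacian is continuous up to the puncture satisfies the equation
  weakly across it, so the test function need not vanish near the origin. For test functions vanishing
  near the origin this is integration by parts. In general the test function is multiplied by the
  cutoff rescaled to radius \<open>d\<close>; the resulting errors are supported in the ball of radius \<open>2 d\<close>, are of
  size \<open>d\<^sup>-\<^sup>4\<close>, and so contribute at most \<open>C d\<^sup>n\<^sup>-\<^sup>4 \<le> C d\<close>.
\<close>

lemma Green_bilaplacian_puncture:
  fixes v F \<phi> :: "real^'n \<Rightarrow> real"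
  assumes n: "5 \<le> CARD('n)"
    and v: "continuous_on UNIV v" "Ck_on 4 (UNIV - {0}) v"
    and F: "continuous_on UNIV F" "\<And>x. x \<noteq> 0 \<Longrightarrow> laplacian (laplacian v) x = F x"
    and p: "Ck_on 4 UNIV \<phi>" and K: "compact K" "\<And>x. x \<notin> K \<Longrightarrow> \<phi> x = 0"
  shows "(\<integral>x. F x * \<phi> x \<partial>lborel) = (\<integral>x. v x * laplacian (laplacian \<phi>) x \<partial>lborel)"
proof -
  let ?n = "CARD('n)"
  let ?B = "cball (0::real^'n) 2"
  obtain M where M: "0 \<le> M" "dbound 4 ?B 1 M (puncture_cutoff :: real^'n \<Rightarrow> real)"
    using Ck_on_imp_dbound[OF _ Ck_on_puncture_cutoff, of ?B] by auto
  obtain N where N: "0 \<le> N" "dbound 4 ?B 1 N \<phi>"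
    using Ck_on_imp_dbound[OF _ p, of ?B] by auto
  have cp: "continuous_on UNIV \<phi>" using Ck_on_continuous[OF p] .
  have cD: "continuous_on UNIV (laplacian (laplacian \<phi>))"
    using continuous_on_bilaplacian[OF open_UNIV p] .
  obtain A where A: "0 \<le> A" "\<And>x. x \<in> ?B \<Longrightarrow> \<bar>F x * \<phi> x\<bar> \<le> A"
    by (rule bounded_on_compact[of "\<lambda>x. F x * \<phi> x" ?B]) (use F(1) cp in \<open>auto intro: continuous_intros\<close>)
  obtain V where V: "0 \<le> V" "\<And>x. x \<in> ?B \<Longrightarrow> \<bar>v x\<bar> \<le> V"
    by (rule bounded_on_compact[OF v(1), of ?B]) auto
  define C where "C = (A + V * ((real ?n)\<^sup>2 * (16 * M * N) + (real ?n)\<^sup>2 * N)) * unit_ball_vol ?n * 2 ^ ?n"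
  have bound: "\<bar>(\<integral>x. F x * \<phi> x \<partial>lborel) - (\<integral>x. v x * laplacian (laplacian \<phi>) x \<partial>lborel)\<bar> \<le> C * d"
    if d: "0 < d" "d \<le> 1" for d :: real
  proof -
    define X where "X x = puncture_cutoff ((1 / d) *\<^sub>R x)" for x :: "real^'n"
    have Cchi: "Ck_on 4 UNIV X"
      using Ck_on_scaled[OF d(1) Ck_on_puncture_cutoff, of 1] by (simp add: X_def [abs_def])
    have Cpc: "Ck_on 4 UNIV (\<lambda>x. X x * \<phi> x)" using Cchi p by (intro Ck_on_mult open_UNIV)
    have chi0: "X x = 0" if "norm x \<le> d" for x
      unfolding X_def using that d by (intro puncture_cutoff_eq_0) (simp add: field_simps)
    have chi1: "X x = 1" if "2 * d \<le> norm x" for x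
      unfolding X_def using that d by (intro puncture_cutoff_eq_1) (simp add: field_simps)
    have chib: "0 \<le> X x" "X x \<le> 1" for x
      unfolding X_def by (auto intro: puncture_cutoff_bounds)
    define K' where "K' = K - ball 0 d"
    have K': "compact K'" "K' \<subseteq> UNIV - {0}"
      unfolding K'_def using K(1) d by (auto intro: compact_diff)
    have off: "X x * \<phi> x = 0" if "x \<notin> K'" for x
      using that K(2)[of x] chi0[of x] by (auto simp: K'_def)
    have cD': "continuous_on UNIV (laplacian (laplacian (\<lambda>x. X x * \<phi> x)))"
      using continuous_on_bilaplacian[OF open_UNIV Cpc] .
    have off2: "laplacian (laplacian (\<lambda>x. X x * \<phi> x)) x = 0" if "x \<notin> K'" for x
      using bilaplacian_cong_open[of "- K'" x "\<lambda>x. X x * \<phi> x" "\<lambda>_. 0"] off that K'(1)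
        laplacian_outside[OF closed_empty, of "\<lambda>_. 0"]
        laplacian_outside[OF closed_empty, of "laplacian (\<lambda>_. 0)"]
      by (auto simp: compact_imp_closed open_Compl)
    have off3: "laplacian (laplacian \<phi>) x = 0" if "x \<notin> K" for x
      using laplacian_outside[OF compact_imp_closed[OF K(1)] laplacian_outside[OF compact_imp_closed[OF K(1)] K(2)] that] .
    have i1: "integrable lborel (\<lambda>x. F x * \<phi> x)"
      by (rule integrable_compact_support[OF _ K(1)]) (use F(1) cp K(2) in \<open>auto intro: continuous_intros\<close>)
    have i2: "integrable lborel (\<lambda>x. F x * (X x * \<phi> x))"
      by (rule integrable_compact_support[OF _ K'(1)])
         (use F(1) off Ck_on_continuous[OF Cpc] in \<open>auto intro: continuous_on_mult\<close>)
    have i3: "integrable lborel (\<lambda>x. v x * laplacian (laplacian \<phi>) x)"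
      by (rule integrable_compact_support[OF _ K(1)]) (use v(1) cD off3 in \<open>auto intro: continuous_intros\<close>)
    have i4: "integrable lborel (\<lambda>x. v x * laplacian (laplacian (\<lambda>x. X x * \<phi> x)) x)"
      by (rule integrable_compact_support[OF _ K'(1)]) (use v(1) cD' off2 in \<open>auto intro: continuous_intros\<close>)
    have eq: "(\<integral>x. F x * (X x * \<phi> x) \<partial>lborel) = (\<integral>x. v x * laplacian (laplacian (\<lambda>x. X x * \<phi> x)) x \<partial>lborel)"
    proof -
      have "F x * (X x * \<phi> x) = laplacian (laplacian v) x * (X x * \<phi> x)" for x
        using F(2)[of x] chi0[of 0] d by (cases "x = 0") auto
      hence "(\<lambda>x. F x * (X x * \<phi> x)) = (\<lambda>x. laplacian (laplacian v) x * (X x * \<phi> x))" by blast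
      thus ?thesis
        using Green_bilaplacian[OF _ K' v(2) Cpc off] by (simp add: open_delete)
    qed
    let ?vol = "measure lborel (cball (0::real^'n) (2 * d))"
    have sub: "x \<in> cball 0 (2 * d) \<Longrightarrow> x \<in> ?B" for x using d by auto
    \<comment> \<open>The cutoff changes this integrand on the ball of radius \<open>2 d\<close> only, where it stays bounded.\<close>
    have e1: "\<bar>\<integral>x. F x * \<phi> x - F x * (X x * \<phi> x) \<partial>lborel\<bar> \<le> A * ?vol"
    proof (rule abs_integral_le_content)
      fix x :: "real^'n"
      show "\<bar>F x * \<phi> x - F x * (X x * \<phi> x)\<bar> \<le> A * indicator (cball 0 (2 * d)) x"
      proof (cases "x \<in> cball 0 (2 * d)")
        case True
        have "F x * \<phi> x - F x * (X x * \<phi> x) = (1 - X x) * (F x * \<phi> x)" by (simp add: algebra_simps)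
        also have "\<bar>\<dots>\<bar> \<le> 1 * A"
          unfolding abs_mult using chib[of x] A(2)[OF sub[OF True]] by (intro mult_mono) auto
        finally show ?thesis using True by simp
      qed (use chi1[of x] in auto)
    qed (use i1 i2 in auto)
    define Q where "Q = V * ((real ?n)\<^sup>2 * (16 * M * N) / d ^ 4 + (real ?n)\<^sup>2 * N)"
    \<comment> \<open>Here up to four derivatives fall on the cutoff, and each of them costs a factor \<open>1 / d\<close>.\<close>
    have e2: "\<bar>\<integral>x. v x * laplacian (laplacian \<phi>) x - v x * laplacian (laplacian (\<lambda>x. X x * \<phi> x)) x \<partial>lborel\<bar> \<le> Q * ?vol"
    proof (rule abs_integral_le_content)
      fix x :: "real^'n"
      show "\<bar>v x * laplacian (laplacian \<phi>) x - v x * laplacian (laplacian (\<lambda>x. X x * \<phi> x)) x\<bar> \<le> Q * indicator (cball 0 (2 * d)) x"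
      proof (cases "x \<in> cball 0 (2 * d)")
        case True
        let ?S = "cball (0::real^'n) (2 * d)"
        have "(*\<^sub>R) (1 / d) ` ?S \<subseteq> ?B" using d by (auto simp: field_simps)
        hence "dbound 4 ((*\<^sub>R) (1 / d) ` ?S) 1 M (puncture_cutoff :: real^'n \<Rightarrow> real)"
          using M(2) dbound_subset by blast
        hence "dbound 4 ?S d M X"
          using dbound_scaled[OF d(1) Ck_on_puncture_cutoff, of 1 ?S M] by (simp add: X_def [abs_def])
        moreover have "dbound 4 ?S d N \<phi>"
          using dbound_smaller_scale[OF d N(1)] dbound_subset[OF _ N(2)] sub by blast
        ultimately have "dbound 4 ?S d (2 ^ 4 * M * N) (\<lambda>x. X x * \<phi> x)"
          using dbound_mult[OF d(1) Cchi p M(1) N(1)] by blast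
        from dbound_bilaplacian[OF d(1) Cpc this True]
        have b1: "\<bar>laplacian (laplacian (\<lambda>x. X x * \<phi> x)) x\<bar> \<le> (real ?n)\<^sup>2 * (16 * M * N) / d ^ 4" by simp
        have b2: "\<bar>laplacian (laplacian \<phi>) x\<bar> \<le> (real ?n)\<^sup>2 * N"
          using dbound_bilaplacian[OF zero_less_one p N(2) sub[OF True]] by simp
        have "\<bar>v x * laplacian (laplacian \<phi>) x - v x * laplacian (laplacian (\<lambda>x. X x * \<phi> x)) x\<bar> =
            \<bar>v x\<bar> * \<bar>laplacian (laplacian \<phi>) x - laplacian (laplacian (\<lambda>x. X x * \<phi> x)) x\<bar>"
          by (simp add: abs_mult [symmetric] algebra_simps)
        also have "\<dots> \<le> Q"
          unfolding Q_def using b1 b2 V(1) V(2)[OF sub[OF True]] by (intro mult_mono) auto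
        finally show ?thesis using True by simp
      next
        case False
        have "laplacian (laplacian (\<lambda>x. X x * \<phi> x)) x = laplacian (laplacian \<phi>) x"
          using False chi1 by (intro bilaplacian_cong_open[of "- cball 0 (2 * d)"]) auto
        thus ?thesis using False by simp
      qed
    qed (use i3 i4 in auto)
    have vol: "?vol = unit_ball_vol ?n * 2 ^ ?n * d ^ ?n"
      using content_cball[of "2 * d" "0::real^'n"] d by (simp add: power_mult_distrib)
    have "A + Q \<le> (A + V * ((real ?n)\<^sup>2 * (16 * M * N) + (real ?n)\<^sup>2 * N)) / d ^ 4"
    proof -
      have d4: "0 < d ^ 4" "d ^ 4 \<le> 1" using d by (auto intro: power_le_one)
      have grow: "y \<le> y / d ^ 4" if "0 \<le> y" for y :: real
        using that d4 by (simp add: field_simps mult_left_le)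
      have "A + Q \<le> A / d ^ 4 + V * ((real ?n)\<^sup>2 * (16 * M * N) / d ^ 4 + (real ?n)\<^sup>2 * N / d ^ 4)"
        unfolding Q_def using A(1) N(1) V(1) by (intro add_mono mult_left_mono grow) auto
      thus ?thesis by (simp add: add_divide_distrib distrib_left)
    qed
    hence "(A + Q) * ?vol \<le> (A + V * ((real ?n)\<^sup>2 * (16 * M * N) + (real ?n)\<^sup>2 * N)) / d ^ 4 * ?vol"
      by (rule mult_right_mono) simp
    also have "\<dots> = C * (d ^ ?n / d ^ 4)" unfolding vol C_def by simp
    also have "\<dots> = C * d ^ (?n - 4)" using n d by (simp add: power_diff)
    also have "\<dots> \<le> C * d ^ 1"
      using n d A(1) V(1) M(1) N(1) unfolding C_def
      by (intro mult_left_mono power_decreasing) auto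
    finally have le: "(A + Q) * ?vol \<le> C * d" by simp
    have "(\<integral>x. F x * \<phi> x \<partial>lborel) - (\<integral>x. v x * laplacian (laplacian \<phi>) x \<partial>lborel) =
        (\<integral>x. F x * \<phi> x - F x * (X x * \<phi> x) \<partial>lborel) -
        (\<integral>x. v x * laplacian (laplacian \<phi>) x - v x * laplacian (laplacian (\<lambda>x. X x * \<phi> x)) x \<partial>lborel)"
      using i1 i2 i3 i4 eq by (simp add: Bochner_Integration.integral_diff)
    thus ?thesis using e1 e2 le by (simp add: distrib_right)
  qed
  define D where "D = \<bar>(\<integral>x. F x * \<phi> x \<partial>lborel) - (\<integral>x. v x * laplacian (laplacian \<phi>) x \<partial>lborel)\<bar>"
  have "((\<lambda>d. C * d) \<longlongrightarrow> C * 0) (at_right 0)"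
    by (intro tendsto_intros)
  moreover have "eventually (\<lambda>d::real. 0 < d \<and> d \<le> 1) (at_right 0)"
    by (intro eventually_at_rightI[of 0 1]) auto
  hence "eventually (\<lambda>d. D \<le> C * d) (at_right 0)"
    by (rule eventually_mono) (use bound in \<open>auto simp: D_def\<close>)
  ultimately have "D \<le> C * 0"
    by (intro tendsto_lowerbound) auto
  thus ?thesis by (simp add: D_def)
qed

section \<open>The radial test functions and their bilaplacian\<close>

text \<open>
  The radial profiles of the test functions as functions of \<open>t = e + \<bar>x - z\<bar>\<^sup>2\<close>: a power of \<open>t\<close> times
  a power of the cutoff \<open>1 - q t\<^sup>2\<close>, which with \<open>q = T\<^sup>-\<^sup>4\<close> ends before distance \<open>T\<close>. The cutoff is taken
  in \<open>t\<^sup>2\<close>, not in \<open>t\<close>: it deviates from 1 only to fourth order in the distance, so that the errors that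
  it causes keep the weight \<open>t\<^sup>-\<^sup>a\<close> itself and not a more singular one.
\<close>

definition prof :: "real \<Rightarrow> real \<Rightarrow> nat \<Rightarrow> real \<Rightarrow> real" where
  "prof q b k t = t powr b * max 0 (1 - q * t\<^sup>2) ^ k"

definition rho :: "real \<Rightarrow> real^'n::finite \<Rightarrow> real^'n \<Rightarrow> real" where
  "rho e z x = e + (norm (x - z))\<^sup>2"

lemma rho_ge: "e \<le> rho e z x" by (simp add: rho_def)

lemma rho_pos: "0 < e \<Longrightarrow> 0 < rho e z x" using rho_ge[of e z x] by linarith

lemma has_pd_rho: "has_pd j (rho e z) (2 * (x - z) $ j) x"
proof -
  have eq: "rho e z = (\<lambda>x. e + (\<Sum>i\<in>UNIV. (x $ i - z $ i)\<^sup>2))"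
    unfolding rho_def norm_power2_vec by (simp add: power2_eq_square)
  have "has_pd j (\<lambda>x. e + (\<Sum>i\<in>UNIV. (x $ i - z $ i)\<^sup>2))
      (0 + (\<Sum>i\<in>UNIV. 2 * (x $ i - z $ i) * (if i = j then 1 else 0))) x"
    by (intro has_pd_add has_pd_const has_pd_sum
          has_pd_chain[where h = "\<lambda>s. (s - z $ i)\<^sup>2" and f = "\<lambda>x. x $ i" for i] has_pd_coord)
       (auto intro!: derivative_eq_intros)
  moreover have "(\<Sum>i\<in>UNIV. 2 * (x $ i - z $ i) * (if i = j then 1 else 0)) = 2 * (x - z) $ j"
    by (simp add: if_distrib[where f = "(*) c" for c] cong: if_cong)
  ultimately show ?thesis unfolding eq by simp
qed

lemma Ck_on_rho: "Ck_on k UNIV (rho e (z :: real^'n::finite))"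
proof -
  have eq: "rho e z = (\<lambda>x. e + (\<Sum>i\<in>UNIV. (x $ i - z $ i) * (x $ i - z $ i)))"
    by (auto simp: rho_def norm_power2_vec)
  show ?thesis unfolding eq
    by (intro Ck_on_add Ck_on_const Ck_on_sum Ck_on_mult Ck_on_diff Ck_on_coord open_UNIV)
qed

lemma Ck_on_prof_rho:
  assumes "0 < e" "k < m"
  shows "Ck_on k UNIV (\<lambda>x. prof q b m (rho e z x))"
proof -
  have "Ck_on k UNIV (\<lambda>x. rho e z x powr b * max 0 (1 - q * (rho e z x * rho e z x)) ^ m)"
    using assms rho_pos
    by (intro Ck_on_mult Ck_on_powr Ck_on_max_power Ck_on_diff Ck_on_const Ck_on_rho open_UNIV) auto
  thus ?thesis by (simp add: prof_def power2_eq_square)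
qed

lemma continuous_on_prof_rho: "0 < e \<Longrightarrow> 0 < l \<Longrightarrow> continuous_on UNIV (\<lambda>x. prof q b l (rho e z x))"
  using Ck_on_prof_rho[of e 0 l q b z] by simp

lemma DERIV_prof:
  assumes "2 \<le> k" "0 < t"
  shows "(prof q b k has_real_derivative
      (b * prof q (b - 1) k t - 2 * real k * q * prof q (b + 1) (k - 1) t)) (at t)"
proof -
  have "((\<lambda>t. max 0 (1 - q * t\<^sup>2) ^ k) has_real_derivative
      (real k * max 0 (1 - q * t\<^sup>2) ^ (k - 1)) * (- (q * (2 * t)))) (at t)"
    by (rule DERIV_chain2[where f = "\<lambda>y. max 0 y ^ k" and g = "\<lambda>t. 1 - q * t\<^sup>2", OF DERIV_max_power[OF assms(1)]])
       (auto intro!: derivative_eq_intros)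
  from DERIV_mult[OF has_real_derivative_powr[OF assms(2), of b] this]
  show ?thesis
    using assms(2) by (simp add: prof_def [abs_def] algebra_simps powr_add)
qed

lemma times_prof: "0 < t \<Longrightarrow> t * prof q b k t = prof q (b + 1) k t"
  by (simp add: prof_def powr_add)

lemma prof_nonneg: "0 \<le> prof q b k t"
  by (simp add: prof_def)

lemma laplacian_radial:
  fixes z :: "real^'n"
  assumes e: "0 < e"
    and G: "\<And>t. 0 < t \<Longrightarrow> (G has_real_derivative G' t) (at t)"
    and G': "\<And>t. 0 < t \<Longrightarrow> (G' has_real_derivative G'' t) (at t)"
  shows "laplacian (\<lambda>x. G (rho e z x)) x =
    2 * real CARD('n) * G' (rho e z x) + 4 * (rho e z x - e) * G'' (rho e z x)"
proof -
  have 1: "partial_deriv j (\<lambda>x. G (rho e z x)) = (\<lambda>x. G' (rho e z x) * (2 * (x $ j - z $ j)))" for j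
    using has_pd_chain[OF G[OF rho_pos[OF e]] has_pd_rho]
    by (intro ext has_pd_partial_deriv) simp
  have 2: "partial_deriv j (\<lambda>x. G' (rho e z x) * (2 * (x $ j - z $ j))) x =
      (G'' (rho e z x) * (2 * (x $ j - z $ j))) * (2 * (x $ j - z $ j)) + 2 * G' (rho e z x)" for j
  proof (rule has_pd_partial_deriv, rule has_pd_mult)
    show "has_pd j (\<lambda>x. G' (rho e z x)) (G'' (rho e z x) * (2 * (x $ j - z $ j))) x"
      using has_pd_chain[OF G'[OF rho_pos[OF e]] has_pd_rho[of j e z x]] by simp
    have "has_pd j (\<lambda>x. 2 * (x $ j - z $ j)) (2 * (if j = j then 1 else 0)) x"
      by (rule has_pd_chain[where h = "\<lambda>s. 2 * (s - z $ j)", OF _ has_pd_coord])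
         (auto intro!: derivative_eq_intros)
    thus "has_pd j (\<lambda>x. 2 * (x $ j - z $ j)) 2 x" by simp
  qed
  have 3: "(\<Sum>j\<in>UNIV. (x $ j - z $ j) * (x $ j - z $ j)) = rho e z x - e"
    by (simp add: rho_def norm_power2_vec)
  have "laplacian (\<lambda>x. G (rho e z x)) x =
      (\<Sum>j\<in>UNIV. 4 * G'' (rho e z x) * ((x $ j - z $ j) * (x $ j - z $ j)) + 2 * G' (rho e z x))"
    unfolding laplacian_def 1 2 by (intro sum.cong refl) (simp add: algebra_simps)
  also have "\<dots> = 4 * G'' (rho e z x) * (rho e z x - e) + 2 * real CARD('n) * G' (rho e z x)"
    unfolding sum.distrib sum_distrib_left [symmetric] 3 by simp
  finally show ?thesis by simp
qed

text \<open>
  The function of \<open>t\<close> that represents the Laplacian of \<^const>\<open>prof\<close> composed with \<^const>\<open>rho\<close>, that is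
  \<open>2 n G' + 4 (t - e) G''\<close> for \<open>G = prof q b k\<close>. The first two terms come from differentiating the power
  only; each of the others carries a factor \<open>q\<close> because the cutoff has been differentiated.
\<close>

definition Lprof :: "real \<Rightarrow> real \<Rightarrow> real \<Rightarrow> real \<Rightarrow> nat \<Rightarrow> real \<Rightarrow> real" where
  "Lprof n e q b k t =
     (2 * n * b + 4 * b * (b - 1)) * prof q (b - 1) k t
     - 4 * b * (b - 1) * e * prof q (b - 2) k t
     - (4 * n * k + 8 * k * (2 * b + 1)) * q * prof q (b + 1) (k - 1) t
     + 8 * k * (2 * b + 1) * e * q * prof q b (k - 1) t
     + 16 * k * (real k - 1) * q\<^sup>2 * prof q (b + 3) (k - 2) t
     - 16 * k * (real k - 1) * e * q\<^sup>2 * prof q (b + 2) (k - 2) t"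

lemma laplacian_prof:
  fixes z :: "real^'n"
  assumes e: "0 < e" and k: "3 \<le> k"
  shows "laplacian (\<lambda>x. prof q b k (rho e z x)) = (\<lambda>x. Lprof (real CARD('n)) e q b k (rho e z x))"
proof
  fix x
  define G' where "G' t = b * prof q (b - 1) k t - 2 * real k * q * prof q (b + 1) (k - 1) t" for t
  define G'' where "G'' t = b * ((b - 1) * prof q (b - 2) k t - 2 * real k * q * prof q b (k - 1) t)
     - 2 * real k * q * ((b + 1) * prof q b (k - 1) t - 2 * (real k - 1) * q * prof q (b + 2) (k - 2) t)" for t
  have 1: "(prof q b k has_real_derivative G' t) (at t)" if "0 < t" for t
    unfolding G'_def using that k by (intro DERIV_prof) auto
  have 2: "(G' has_real_derivative G'' t) (at t)" if "0 < t" for t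
  proof -
    have "((\<lambda>t. b * prof q (b - 1) k t - 2 * real k * q * prof q (b + 1) (k - 1) t) has_real_derivative
      b * ((b - 1) * prof q (b - 1 - 1) k t - 2 * real k * q * prof q (b - 1 + 1) (k - 1) t)
      - 2 * real k * q * ((b + 1) * prof q (b + 1 - 1) (k - 1) t - 2 * real (k - 1) * q * prof q (b + 1 + 1) (k - 1 - 1) t)) (at t)"
      using that k by (intro DERIV_diff DERIV_cmult DERIV_prof) auto
    moreover have "b + 1 + 1 = b + 2" "b - 1 - 1 = b - 2" "b - 1 + 1 = b" "b + 1 - 1 = b" "k - 1 - 1 = k - 2" "real (k - 1) = real k - 1"
      using k by auto
    ultimately show ?thesis unfolding G'_def [abs_def] G''_def by simp
  qed
  let ?t = "rho e z x"
  have t: "0 < ?t" using e by (rule rho_pos)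
  have s: "prof q (b - 1) k ?t = ?t * prof q (b - 2) k ?t"
     "prof q (b + 1) (k - 1) ?t = ?t * prof q b (k - 1) ?t"
     "prof q (b + 3) (k - 2) ?t = ?t * prof q (b + 2) (k - 2) ?t"
    using times_prof[OF t, of q] by (simp_all add: add.commute)
  show "laplacian (\<lambda>x. prof q b k (rho e z x)) x = Lprof (real CARD('n)) e q b k (rho e z x)"
  proof (rule trans[OF laplacian_radial[OF e 1 2]])
    show "2 * real CARD('n) * G' ?t + 4 * (?t - e) * G'' ?t = Lprof (real CARD('n)) e q b k ?t"
      unfolding G'_def G''_def Lprof_def s by (simp add: algebra_simps power2_eq_square)
  qed simp_all
qed

text \<open>
  Homogeneity: \<open>e\<close> is at most \<open>t\<close>, and \<open>q\<close> is at most \<open>1 / t\<^sup>2\<close> wherever the cutoff does not vanish. Thus all terms with the same total degree obey the same bound.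
\<close>

lemma prof_term_le:
  assumes "0 < e" "e \<le> t" "0 \<le> q" "l \<le> k" "1 \<le> l" "c = b + 2 * real j - real i"
  shows "q ^ j * e ^ i * prof q c k t \<le> prof q b l t"
proof (cases "q * t\<^sup>2 < 1")
  case True
  have t: "0 < t" using assms by linarith
  have "q ^ j * e ^ i * prof q c k t \<le> q ^ j * t ^ i * prof q c k t"
    using assms by (intro mult_right_mono mult_left_mono power_mono prof_nonneg) auto
  also have "q ^ j * t ^ i * prof q c k t = q ^ j * t ^ i * (t powr b * (t\<^sup>2) ^ j / t ^ i * max 0 (1 - q * t\<^sup>2) ^ k)"
  proof -
    have "c = b + real (2 * j) - real i" using assms(6) by simp
    hence "t powr c = t powr b * t ^ (2 * j) / t ^ i"
      by (simp only: powr_add powr_diff powr_realpow[OF t])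
    thus ?thesis by (simp only: prof_def power_mult)
  qed
  also have "\<dots> =
     (q * t\<^sup>2) ^ j * (t powr b * max 0 (1 - q * t\<^sup>2) ^ k)"
    using t by (simp add: power_mult_distrib)
  also have "\<dots> \<le> 1 * (t powr b * max 0 (1 - q * t\<^sup>2) ^ l)"
    using True assms by (intro mult_mono mult_left_mono power_decreasing power_le_one) auto
  finally show ?thesis by (simp add: prof_def)
next
  case False
  thus ?thesis using assms by (simp add: prof_def max_def power_0_left)
qed

lemma abs_mult_le: "0 \<le> x \<Longrightarrow> x \<le> y \<Longrightarrow> \<bar>c * x\<bar> \<le> \<bar>c\<bar> * (y::real)"
  by (simp add: abs_mult mult_left_mono)

lemma abs_le_rescale:
  fixes X :: real
  assumes "\<bar>X\<bar> \<le> C * P" "0 \<le> C" "0 \<le> k" "k * P \<le> Y"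
  shows "\<bar>k * X\<bar> \<le> C * Y"
proof -
  have "\<bar>k * X\<bar> \<le> k * (C * P)" using assms(1,3) by (simp add: abs_mult mult_left_mono)
  also have "\<dots> = C * (k * P)" by simp
  also have "\<dots> \<le> C * Y" using assms(2,4) by (intro mult_left_mono)
  finally show ?thesis .
qed

text \<open>
  The terms in which the cutoff is differentiated are smaller by the factor \<open>q t\<^sup>2\<close> than the main ones.
\<close>

lemma Lprof_main_error:
  assumes "3 \<le> k"
  obtains C where "0 \<le> C" "\<And>e q t. 0 < e \<Longrightarrow> e \<le> t \<Longrightarrow> 0 \<le> q \<Longrightarrow>
    \<bar>Lprof n e q b k t - ((2 * n * b + 4 * b * (b - 1)) * prof q (b - 1) k t
     - 4 * b * (b - 1) * e * prof q (b - 2) k t)\<bar> \<le> C * (q * prof q (b + 1) (k - 2) t)"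
proof
  let ?c3 = "- (4 * n * k + 8 * k * (2 * b + 1))" and ?c4 = "8 * k * (2 * b + 1)"
    and ?c5 = "16 * k * (real k - 1)"
  show "0 \<le> \<bar>?c3\<bar> + \<bar>?c4\<bar> + \<bar>?c5\<bar> + \<bar>- ?c5\<bar>" by simp
  fix e q t :: real assume a: "0 < e" "e \<le> t" "0 \<le> q"
  have p: "q * (q ^ j * e ^ i * prof q c l t) \<le> q * prof q (b + 1) (k - 2) t"
    if "k - 2 \<le> l" "c = b + 1 + 2 * real j - real i" for c l j i
    using prof_term_le[OF a that(1) _ that(2)] assms a by (intro mult_left_mono) auto
  have nn: "0 \<le> q * (q ^ j * e ^ i * prof q c l t)" for j i c l
    using a prof_nonneg by (intro mult_nonneg_nonneg) auto
  have "\<bar>?c3 * (q * (q ^ 0 * e ^ 0 * prof q (b + 1) (k - 1) t)) + ?c4 * (q * (q ^ 0 * e ^ 1 * prof q b (k - 1) t))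
     + ?c5 * (q * (q ^ 1 * e ^ 0 * prof q (b + 3) (k - 2) t)) + (- ?c5) * (q * (q ^ 1 * e ^ 1 * prof q (b + 2) (k - 2) t))\<bar>
    \<le> \<bar>?c3\<bar> * (q * prof q (b + 1) (k - 2) t) + \<bar>?c4\<bar> * (q * prof q (b + 1) (k - 2) t)
     + \<bar>?c5\<bar> * (q * prof q (b + 1) (k - 2) t) + \<bar>- ?c5\<bar> * (q * prof q (b + 1) (k - 2) t)"
    by (intro order_trans[OF abs_triangle_ineq] add_mono abs_mult_le nn p) auto
  thus "\<bar>Lprof n e q b k t - ((2 * n * b + 4 * b * (b - 1)) * prof q (b - 1) k t
     - 4 * b * (b - 1) * e * prof q (b - 2) k t)\<bar> \<le> (\<bar>?c3\<bar> + \<bar>?c4\<bar> + \<bar>?c5\<bar> + \<bar>- ?c5\<bar>) * (q * prof q (b + 1) (k - 2) t)"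
    unfolding Lprof_def by (simp add: algebra_simps power2_eq_square)
qed

lemma Lprof_le:
  assumes "3 \<le> k"
  obtains C where "0 \<le> C" "\<And>e q t. 0 < e \<Longrightarrow> e \<le> t \<Longrightarrow> 0 \<le> q \<Longrightarrow>
    \<bar>Lprof n e q b k t\<bar> \<le> C * prof q (b - 1) (k - 2) t"
proof -
  obtain C where C: "0 \<le> C" "\<And>e q t. 0 < e \<Longrightarrow> e \<le> t \<Longrightarrow> 0 \<le> q \<Longrightarrow>
    \<bar>Lprof n e q b k t - ((2 * n * b + 4 * b * (b - 1)) * prof q (b - 1) k t
     - 4 * b * (b - 1) * e * prof q (b - 2) k t)\<bar> \<le> C * (q * prof q (b + 1) (k - 2) t)"
    using Lprof_main_error[OF assms] by metis
  let ?c1 = "2 * n * b + 4 * b * (b - 1)" and ?c2 = "4 * b * (b - 1)"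
  show ?thesis
  proof (rule that[of "\<bar>?c1\<bar> + \<bar>?c2\<bar> + C"])
    fix e q t :: real assume a: "0 < e" "e \<le> t" "0 \<le> q"
    let ?P = "prof q (b - 1) (k - 2) t"
    have p: "q ^ j * e ^ i * prof q c l t \<le> ?P"
      if "k - 2 \<le> l" "c = b - 1 + 2 * real j - real i" for c l j i
      using prof_term_le[OF a that(1) _ that(2)] assms by auto
    have "\<bar>?c1 * prof q (b - 1) k t\<bar> \<le> \<bar>?c1\<bar> * ?P"
      using p[of k "b - 1" 0 0] by (intro abs_mult_le prof_nonneg) auto
    moreover have "\<bar>?c2 * (e * prof q (b - 2) k t)\<bar> \<le> \<bar>?c2\<bar> * ?P"
      using p[of k "b - 2" 0 1] a by (intro abs_mult_le mult_nonneg_nonneg prof_nonneg) auto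
    moreover have "C * (q * prof q (b + 1) (k - 2) t) \<le> C * ?P"
      using p[of "k - 2" "b + 1" 1 0] C(1) by (intro mult_left_mono) auto
    moreover note C(2)[OF a]
    ultimately show "\<bar>Lprof n e q b k t\<bar> \<le> (\<bar>?c1\<bar> + \<bar>?c2\<bar> + C) * ?P"
      by (simp only: mult.assoc distrib_right) linarith
  qed (use C in auto)
qed

lemma laplacian_lincomb6:
  assumes "Ck_on 2 UNIV f1" "Ck_on 2 UNIV f2" "Ck_on 2 UNIV f3"
    "Ck_on 2 UNIV f4" "Ck_on 2 UNIV f5" "Ck_on 2 UNIV f6"
  shows "laplacian (\<lambda>x. c1 * f1 x + c2 * f2 x + c3 * f3 x + c4 * f4 x + c5 * f5 x + c6 * f6 x) x =
    c1 * laplacian f1 x + c2 * laplacian f2 x + c3 * laplacian f3 x + c4 * laplacian f4 x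
    + c5 * laplacian f5 x + c6 * laplacian f6 x"
  using assms by (simp add: laplacian_add laplacian_cmult Ck_on_add Ck_on_cmult)

text \<open>
  The cancellation behind \<open>\<Delta>\<^sup>2 (e + r\<^sup>2)\<^sup>-\<^sup>a = const e\<^sup>2 (e + r\<^sup>2)\<^sup>-\<^sup>a\<^sup>-\<^sup>4\<close>: the contributions of the power
  \<open>-a - 3\<close> from the two main terms cancel.
\<close>

lemma bilaplacian_prof_algebra:
  fixes a :: real
  shows "(- 4 * a) * (R1 - 4 * (a + 1) * (a + 2) * e * P3)
      + (- 4 * a * (a + 1) * e) * (R2 + 4 * (a + 2) * P3 - 4 * (a + 2) * (a + 3) * e * P4)
      + (- c3 * q) * X3 + (c4 * e * q) * X4 + (c5 * q\<^sup>2) * X5 + (- c5 * e * q\<^sup>2) * X6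
    = 16 * a * (a + 1) * (a + 2) * (a + 3) * (e\<^sup>2 * P4)
      + (- 4 * a) * R1 + (- (4 * a * (a + 1))) * (e * R2)
      + (- c3) * (q * X3) + c4 * (q * e * X4) + c5 * (q\<^sup>2 * X5) + (- c5) * (q\<^sup>2 * e * X6)"
  by algebra

text \<open>
  For \<open>a = (n - 4) / 2\<close> the power \<open>\<bar>x\<bar>\<^sup>-\<^sup>2\<^sup>a\<close> is biharmonic, so the main part of the bilaplacian is the
  regularized point mass with weight \<open>e\<^sup>2\<close>. All remaining terms contain a derivative of the cutoff,
  hence a factor \<open>q\<close>, and at least \<open>m - 4\<close> powers of the cutoff survive.
\<close>

lemma bilaplacian_prof:
  fixes z :: "real^'n" and a :: real
  assumes m: "5 \<le> m" and a: "a = (real CARD('n) - 4) / 2"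
  obtains C where "0 \<le> C" "\<And>e q x. 0 < e \<Longrightarrow> 0 \<le> q \<Longrightarrow>
    \<bar>laplacian (laplacian (\<lambda>x. prof q (- a) m (rho e z x))) x
      - 16 * a * (a + 1) * (a + 2) * (a + 3) * (e\<^sup>2 * prof q (- a - 4) m (rho e z x))\<bar>
    \<le> C * (q * prof q (- a) (m - 4) (rho e z x))"
proof -
  define N where "N = real CARD('n)"
  have N: "N = 2 * a + 4" using a by (simp add: N_def)
  define c3 where "c3 = 4 * N * m + 8 * m * (2 * (- a) + 1)"
  define c4 where "c4 = 8 * m * (2 * (- a) + 1)"
  define c5 where "c5 = 16 * m * (real m - 1)"
  define R where "R b e q t = Lprof N e q b m t - ((2 * N * b + 4 * b * (b - 1)) * prof q (b - 1) m t
     - 4 * b * (b - 1) * e * prof q (b - 2) m t)" for b e q t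
  have m3: "3 \<le> m" "3 \<le> m - 1" "3 \<le> m - 2" using m by auto
  obtain C1 where C1: "0 \<le> C1" "\<And>e q t. 0 < e \<Longrightarrow> e \<le> t \<Longrightarrow> 0 \<le> q \<Longrightarrow>
      \<bar>R (- a - 1) e q t\<bar> \<le> C1 * (q * prof q (- a - 1 + 1) (m - 2) t)"
    using Lprof_main_error[OF m3(1), of N "- a - 1"] unfolding R_def by metis
  obtain C2 where C2: "0 \<le> C2" "\<And>e q t. 0 < e \<Longrightarrow> e \<le> t \<Longrightarrow> 0 \<le> q \<Longrightarrow>
      \<bar>R (- a - 2) e q t\<bar> \<le> C2 * (q * prof q (- a - 2 + 1) (m - 2) t)"
    using Lprof_main_error[OF m3(1), of N "- a - 2"] unfolding R_def by metis
  obtain C3 where C3: "0 \<le> C3" "\<And>e q t. 0 < e \<Longrightarrow> e \<le> t \<Longrightarrow> 0 \<le> q \<Longrightarrow>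
      \<bar>Lprof N e q (- a + 1) (m - 1) t\<bar> \<le> C3 * prof q (- a + 1 - 1) (m - 1 - 2) t"
    using Lprof_le[OF m3(2), of N "- a + 1"] by metis
  obtain C4 where C4: "0 \<le> C4" "\<And>e q t. 0 < e \<Longrightarrow> e \<le> t \<Longrightarrow> 0 \<le> q \<Longrightarrow>
      \<bar>Lprof N e q (- a) (m - 1) t\<bar> \<le> C4 * prof q (- a - 1) (m - 1 - 2) t"
    using Lprof_le[OF m3(2), of N "- a"] by metis
  obtain C5 where C5: "0 \<le> C5" "\<And>e q t. 0 < e \<Longrightarrow> e \<le> t \<Longrightarrow> 0 \<le> q \<Longrightarrow>
      \<bar>Lprof N e q (- a + 3) (m - 2) t\<bar> \<le> C5 * prof q (- a + 3 - 1) (m - 2 - 2) t"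
    using Lprof_le[OF m3(3), of N "- a + 3"] by metis
  obtain C6 where C6: "0 \<le> C6" "\<And>e q t. 0 < e \<Longrightarrow> e \<le> t \<Longrightarrow> 0 \<le> q \<Longrightarrow>
      \<bar>Lprof N e q (- a + 2) (m - 2) t\<bar> \<le> C6 * prof q (- a + 2 - 1) (m - 2 - 2) t"
    using Lprof_le[OF m3(3), of N "- a + 2"] by metis
  define C where "C = \<bar>- 4 * a\<bar> * C1 + \<bar>4 * a * (a + 1)\<bar> * C2 + \<bar>c3\<bar> * C3 + \<bar>c4\<bar> * C4 + \<bar>c5\<bar> * C5 + \<bar>c5\<bar> * C6"
  show ?thesis
  proof (rule that[of C])
    show "0 \<le> C" unfolding C_def using C1(1) C2(1) C3(1) C4(1) C5(1) C6(1) by simp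
    fix e q :: real and x :: "real^'n" assume e: "0 < e" and q: "0 \<le> q"
    let ?t = "rho e z x"
    have et: "e \<le> ?t" by (rule rho_ge)
    define Y where "Y = q * prof q (- a) (m - 4) ?t"
    have Y: "q * (q ^ j * e ^ i * prof q c l ?t) \<le> Y"
      if "m - 4 \<le> l" "c = - a + 2 * real j - real i" for c l j i
      unfolding Y_def using prof_term_le[OF e et q that(1) _ that(2)] m q by (intro mult_left_mono) auto
    have sh: "- a - 1 - 1 = - a - 2" "- a - 1 - 2 = - a - 3" "- a - 2 - 1 = - a - 3" "- a - 2 - 2 = - a - 4"
      by simp_all
    note R = R_def[of "- a - 1" e q ?t] R_def[of "- a - 2" e q ?t]
    note R = R[unfolded sh]
    \<comment> \<open>Here the choice of \<open>a\<close> enters: \<open>\<bar>x\<bar>\<^sup>-\<^sup>2\<^sup>(\<^sup>a\<^sup>+\<^sup>1\<^sup>)\<close> is harmonic.\<close>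
    have c: "2 * N * (- a - 1) + 4 * (a + 1) * (a + 2) = 0"
      "4 * (- a - 1) * (- a - 2) = 4 * (a + 1) * (a + 2)"
      "2 * N * (- a - 2) + 4 * (a + 2) * (a + 3) = 4 * (a + 2)"
      "4 * (- a - 2) * (- a - 3) = 4 * (a + 2) * (a + 3)"
      unfolding N by (simp_all add: algebra_simps)
    have L1: "Lprof N e q (- a - 1) m ?t = R (- a - 1) e q ?t - 4 * (a + 1) * (a + 2) * e * prof q (- a - 3) m ?t"
      unfolding R(1) c by simp
    have L2: "Lprof N e q (- a - 2) m ?t = R (- a - 2) e q ?t + 4 * (a + 2) * prof q (- a - 3) m ?t
        - 4 * (a + 2) * (a + 3) * e * prof q (- a - 4) m ?t"
      unfolding R(2) c by simp
    have ck: "Ck_on 2 UNIV (\<lambda>x. prof q c l (rho e z x))" if "3 \<le> l" for c l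
      using that e by (intro Ck_on_prof_rho) auto
    define H where "H = (\<lambda>x.
        (- 4 * a) * prof q (- a - 1) m (rho e z x) + (- 4 * a * (a + 1) * e) * prof q (- a - 2) m (rho e z x)
        + (- c3 * q) * prof q (- a + 1) (m - 1) (rho e z x) + (c4 * e * q) * prof q (- a) (m - 1) (rho e z x)
        + (c5 * q\<^sup>2) * prof q (- a + 3) (m - 2) (rho e z x) + (- c5 * e * q\<^sup>2) * prof q (- a + 2) (m - 2) (rho e z x))"
    have eq1: "laplacian (\<lambda>x. prof q (- a) m (rho e z x)) = H"
      unfolding laplacian_prof[OF e m3(1)] N_def[symmetric] H_def Lprof_def c3_def c4_def c5_def
      by (intro ext) (simp add: N algebra_simps)
    have eq2: "laplacian H x =
        (- 4 * a) * Lprof N e q (- a - 1) m ?t + (- 4 * a * (a + 1) * e) * Lprof N e q (- a - 2) m ?t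
        + (- c3 * q) * Lprof N e q (- a + 1) (m - 1) ?t + (c4 * e * q) * Lprof N e q (- a) (m - 1) ?t
        + (c5 * q\<^sup>2) * Lprof N e q (- a + 3) (m - 2) ?t + (- c5 * e * q\<^sup>2) * Lprof N e q (- a + 2) (m - 2) ?t"
      unfolding H_def laplacian_lincomb6[OF ck[OF m3(1)] ck[OF m3(1)] ck[OF m3(2)] ck[OF m3(2)] ck[OF m3(3)] ck[OF m3(3)]]
        laplacian_prof[OF e m3(1)] laplacian_prof[OF e m3(2)] laplacian_prof[OF e m3(3)] N_def[symmetric] ..
    have eq: "laplacian (laplacian (\<lambda>x. prof q (- a) m (rho e z x))) x =
        16 * a * (a + 1) * (a + 2) * (a + 3) * (e\<^sup>2 * prof q (- a - 4) m ?t)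
        + (- 4 * a) * R (- a - 1) e q ?t + (- (4 * a * (a + 1))) * (e * R (- a - 2) e q ?t)
        + (- c3) * (q * Lprof N e q (- a + 1) (m - 1) ?t) + c4 * (q * e * Lprof N e q (- a) (m - 1) ?t)
        + c5 * (q\<^sup>2 * Lprof N e q (- a + 3) (m - 2) ?t) + (- c5) * (q\<^sup>2 * e * Lprof N e q (- a + 2) (m - 2) ?t)"
      unfolding eq1 eq2 L1 L2 by (rule bilaplacian_prof_algebra)
    have y: "1 * (q * prof q (- a - 1 + 1) (m - 2) ?t) \<le> Y"
      "e * (q * prof q (- a - 2 + 1) (m - 2) ?t) \<le> Y"
      "q * prof q (- a + 1 - 1) (m - 1 - 2) ?t \<le> Y"
      "q * e * prof q (- a - 1) (m - 1 - 2) ?t \<le> Y"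
      "q\<^sup>2 * prof q (- a + 3 - 1) (m - 2 - 2) ?t \<le> Y"
      "q\<^sup>2 * e * prof q (- a + 2 - 1) (m - 2 - 2) ?t \<le> Y"
    proof -
      have "m - 4 \<le> m - 2" "m - 4 \<le> m - 1 - 2" "m - 4 \<le> m - 2 - 2" by auto
      note Y' = Y[OF this(1), of "- a - 1 + 1" 0 0] Y[OF this(1), of "- a - 2 + 1" 0 1]
        Y[OF this(2), of "- a + 1 - 1" 0 0] Y[OF this(2), of "- a - 1" 0 1]
        Y[OF this(3), of "- a + 3 - 1" 1 0] Y[OF this(3), of "- a + 2 - 1" 1 1]
      show "1 * (q * prof q (- a - 1 + 1) (m - 2) ?t) \<le> Y" using Y'(1) by simp
      show "e * (q * prof q (- a - 2 + 1) (m - 2) ?t) \<le> Y" using Y'(2) by (simp add: mult_ac)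
      show "q * prof q (- a + 1 - 1) (m - 1 - 2) ?t \<le> Y" using Y'(3) by simp
      show "q * e * prof q (- a - 1) (m - 1 - 2) ?t \<le> Y" using Y'(4) by (simp add: mult_ac)
      show "q\<^sup>2 * prof q (- a + 3 - 1) (m - 2 - 2) ?t \<le> Y"
        using Y'(5) by (simp add: mult_ac power2_eq_square)
      show "q\<^sup>2 * e * prof q (- a + 2 - 1) (m - 2 - 2) ?t \<le> Y"
        using Y'(6) by (simp add: mult_ac power2_eq_square)
    qed
    have b1: "\<bar>1 * R (- a - 1) e q ?t\<bar> \<le> C1 * Y"
      by (rule abs_le_rescale[OF C1(2)[OF e et q] C1(1) _ y(1)]) simp
    have b2: "\<bar>e * R (- a - 2) e q ?t\<bar> \<le> C2 * Y"
      by (rule abs_le_rescale[OF C2(2)[OF e et q] C2(1) _ y(2)]) (use e in simp)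
    have b3: "\<bar>q * Lprof N e q (- a + 1) (m - 1) ?t\<bar> \<le> C3 * Y"
      by (rule abs_le_rescale[OF C3(2)[OF e et q] C3(1) _ y(3)]) (use q in simp)
    have b4: "\<bar>q * e * Lprof N e q (- a) (m - 1) ?t\<bar> \<le> C4 * Y"
      by (rule abs_le_rescale[OF C4(2)[OF e et q] C4(1) _ y(4)]) (use q e in simp)
    have b5: "\<bar>q\<^sup>2 * Lprof N e q (- a + 3) (m - 2) ?t\<bar> \<le> C5 * Y"
      by (rule abs_le_rescale[OF C5(2)[OF e et q] C5(1) _ y(5)]) (use q in simp)
    have b6: "\<bar>q\<^sup>2 * e * Lprof N e q (- a + 2) (m - 2) ?t\<bar> \<le> C6 * Y"
      by (rule abs_le_rescale[OF C6(2)[OF e et q] C6(1) _ y(6)]) (use q e in simp)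
    note b1 = b1[unfolded mult_1]
    have "\<bar>(- 4 * a) * R (- a - 1) e q ?t + (- (4 * a * (a + 1))) * (e * R (- a - 2) e q ?t)
        + (- c3) * (q * Lprof N e q (- a + 1) (m - 1) ?t) + c4 * (q * e * Lprof N e q (- a) (m - 1) ?t)
        + c5 * (q\<^sup>2 * Lprof N e q (- a + 3) (m - 2) ?t) + (- c5) * (q\<^sup>2 * e * Lprof N e q (- a + 2) (m - 2) ?t)\<bar>
      \<le> \<bar>- 4 * a\<bar> * (C1 * Y) + \<bar>- (4 * a * (a + 1))\<bar> * (C2 * Y) + \<bar>- c3\<bar> * (C3 * Y) + \<bar>c4\<bar> * (C4 * Y)
        + \<bar>c5\<bar> * (C5 * Y) + \<bar>- c5\<bar> * (C6 * Y)"
      by (intro order_trans[OF abs_triangle_ineq] add_mono order_trans[OF eq_refl[OF abs_mult]] mult_left_mono b1 b2 b3 b4 b5 b6 abs_ge_zero)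
    also have "\<dots> = C * Y" unfolding C_def by (simp only: distrib_right mult.assoc abs_minus_cancel)
    finally show "\<bar>laplacian (laplacian (\<lambda>x. prof q (- a) m (rho e z x))) x
      - 16 * a * (a + 1) * (a + 2) * (a + 3) * (e\<^sup>2 * prof q (- a - 4) m (rho e z x))\<bar>
      \<le> C * (q * prof q (- a) (m - 4) (rho e z x))"
      unfolding eq Y_def by (simp add: algebra_simps)
  qed
qed

lemma prof_rho_outside:
  assumes "0 < e" "0 < T" "0 < l" "x \<notin> cball z T"
  shows "prof (1 / T ^ 4) b l (rho e z x) = 0"
proof -
  have "T\<^sup>2 \<le> (norm (x - z))\<^sup>2"
    using assms by (intro power_mono) (auto simp: dist_norm norm_minus_commute)
  hence "T\<^sup>2 \<le> rho e z x" using assms unfolding rho_def by linarith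
  hence "(T\<^sup>2)\<^sup>2 \<le> (rho e z x)\<^sup>2" by (intro power_mono) auto
  hence "1 \<le> 1 / T ^ 4 * (rho e z x)\<^sup>2" using assms by (simp add: field_simps flip: power_mult)
  hence "max 0 (1 - 1 / T ^ 4 * (rho e z x)\<^sup>2) = 0" by (simp add: max_def)
  thus ?thesis unfolding prof_def using assms by (simp only: zero_power mult_zero_right)
qed

lemma prof_le_powr: "0 \<le> q \<Longrightarrow> prof q b l t \<le> t powr b"
  unfolding prof_def by (intro mult_left_le power_le_one) auto

section \<open>The integral of the weight\<close>

lemma integral_lborel_affine:
  fixes f :: "'a::euclidean_space \<Rightarrow> real"
  assumes [measurable]: "f \<in> borel_measurable borel" and "c \<noteq> 0"
  shows "(\<integral>x. f x \<partial>lborel) = \<bar>c\<bar> ^ DIM('a) * (\<integral>x. f (t + c *\<^sub>R x) \<partial>lborel)"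
  by (subst lborel_affine[OF assms(2), of t]) (simp add: integral_density integral_distr)

lemma continuous_on_rho: "continuous_on UNIV (rho e z)"
  using Ck_on_continuous[OF Ck_on_rho[of 0]] .

lemma integrable_rho_powr:
  assumes "0 < e"
  shows "integrable lborel (\<lambda>x. indicator (cball z R) x * rho e z x powr b)"
proof -
  have "continuous_on (cball z R) (\<lambda>x. rho e z x powr b)"
    using rho_pos[OF assms] by (intro continuous_on_powr continuous_on_const
        continuous_on_subset[OF continuous_on_rho]) (auto simp: less_le)
  from borel_integrable_compact[OF compact_cball this] show ?thesis by simp
qed

text \<open>
  Split the ball of radius \<open>R\<close> into the ball of radius \<open>R / 2\<close> and a shell. On the shell the weight is at
  most \<open>(R / 2)\<^sup>-\<^sup>2\<^sup>a\<close>, which contributes a multiple of \<open>R\<^sup>4\<close>. The inner ball is rescaled to the full one,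
  which produces the factor \<open>2\<^sup>2\<^sup>a\<^sup>-\<^sup>n = 1 / 16\<close>; the integral over it can therefore be absorbed. In this
  way the bound is independent of \<open>e\<close>.
\<close>

lemma integral_rho_powr_le:
  fixes z :: "real^'n" and a :: real
  assumes a: "a = (real CARD('n) - 4) / 2" "0 < a"
  obtains C where "0 \<le> C" "\<And>e R. 0 < e \<Longrightarrow> 0 < R \<Longrightarrow>
    (\<integral>x. indicator (cball z R) x * rho e z x powr (- a) \<partial>lborel) \<le> C * R ^ 4"
proof
  let ?n = "CARD('n)"
  define K where "K = 4 powr a * unit_ball_vol ?n"
  show "0 \<le> 2 * K" by (simp add: K_def)
  fix e R :: real assume e: "0 < e" and R: "0 < R"
  define I where "I r = (\<integral>x. indicator (cball z r) x * rho e z x powr (- a) \<partial>lborel)" for r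
  have "I R \<le> (\<integral>x. indicator (cball z (R / 2)) x * rho e z x powr (- a)
      + (R\<^sup>2 / 4) powr (- a) * indicator (cball z R) x \<partial>lborel)"
    unfolding I_def
  proof (rule Bochner_Integration.integral_mono)
    show "integrable lborel (\<lambda>x. indicator (cball z (R / 2)) x * rho e z x powr (- a)
      + (R\<^sup>2 / 4) powr (- a) * indicator (cball z R) x)"
      using emeasure_bounded_finite[of "cball z R"]
      by (intro Bochner_Integration.integrable_add integrable_rho_powr e integrable_mult_right integrable_real_indicator) auto
    fix x
    show "indicator (cball z R) x * rho e z x powr (- a) \<le> indicator (cball z (R / 2)) x * rho e z x powr (- a)
      + (R\<^sup>2 / 4) powr (- a) * indicator (cball z R) x"
    proof (cases "x \<in> cball z R \<and> x \<notin> cball z (R / 2)")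
      case True
      hence "(R / 2)\<^sup>2 \<le> (norm (x - z))\<^sup>2"
        using R by (intro power_mono) (auto simp: dist_norm norm_minus_commute)
      hence "R\<^sup>2 / 4 \<le> rho e z x" using e by (simp add: rho_def power_divide)
      hence "rho e z x powr (- a) \<le> (R\<^sup>2 / 4) powr (- a)"
        using R a by (intro powr_mono2') auto
      thus ?thesis using True by simp
    qed (auto simp: indicator_def)
  qed (rule integrable_rho_powr[OF e])
  also have "\<dots> = I (R / 2) + (R\<^sup>2 / 4) powr (- a) * measure lborel (cball z R)"
    unfolding I_def using emeasure_bounded_finite[of "cball z R"]
    by (subst Bochner_Integration.integral_add)
       (auto intro!: integrable_rho_powr e integrable_mult_right integrable_real_indicator)
  also have "(R\<^sup>2 / 4) powr (- a) * measure lborel (cball z R) = K * R ^ 4"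
  proof -
    have "(R\<^sup>2 / 4) powr (- a) = 4 powr a * R powr (- 2 * a)"
    proof -
      have "R\<^sup>2 = R powr 2" using R by simp
      hence "(R\<^sup>2) powr (- a) = R powr (- 2 * a)" by (simp only: powr_powr) simp
      thus ?thesis by (simp add: powr_divide powr_minus_divide)
    qed
    moreover have "R powr (- 2 * a) * R ^ ?n = R ^ 4"
    proof -
      have "R powr (- 2 * a) * R powr real ?n = R powr 4"
      proof -
        have "- 2 * a + real ?n = 4" using a(1) by (simp add: field_simps)
        thus ?thesis by (simp only: powr_add [symmetric])
      qed
      thus ?thesis using R by (simp add: powr_realpow)
    qed
    ultimately show ?thesis
      using content_cball[of R z] R by (simp add: K_def algebra_simps)
  qed
  also have "I (R / 2) \<le> I R / 16"
  proof -
    have meas: "(\<lambda>x. indicator (cball z (R / 2)) x * rho e z x powr (- a)) \<in> borel_measurable borel"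
      using borel_measurable_integrable[OF integrable_rho_powr[OF e, of z "R / 2" "- a"]] by simp
    have "I (R / 2) = (1 / 2) ^ ?n * (\<integral>x. indicator (cball z (R / 2)) ((1 / 2) *\<^sub>R z + (1 / 2) *\<^sub>R x)
        * rho e z ((1 / 2) *\<^sub>R z + (1 / 2) *\<^sub>R x) powr (- a) \<partial>lborel)"
      unfolding I_def by (subst integral_lborel_affine[OF meas, where c = "1 / 2" and t = "(1 / 2) *\<^sub>R z"]) simp_all
    also have "\<dots> \<le> (1 / 2) ^ ?n * (\<integral>x. 4 powr a * (indicator (cball z R) x * rho e z x powr (- a)) \<partial>lborel)"
    proof (intro mult_left_mono integral_mono')
      fix x
      have sh: "(1 / 2) *\<^sub>R z + (1 / 2) *\<^sub>R x - z = (1 / 2) *\<^sub>R (x - z)"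
        by (simp add: algebra_simps flip: scaleR_add_left)
      have n: "norm ((1 / 2) *\<^sub>R z + (1 / 2) *\<^sub>R x - z) = norm (x - z) / 2"
        unfolding sh by simp
      have "rho e z x / 4 \<le> rho e z ((1 / 2) *\<^sub>R z + (1 / 2) *\<^sub>R x)"
        unfolding rho_def n using e by (simp add: power_divide)
      hence "rho e z ((1 / 2) *\<^sub>R z + (1 / 2) *\<^sub>R x) powr (- a) \<le> (rho e z x / 4) powr (- a)"
        using a rho_pos[OF e, of z x] by (intro powr_mono2') auto
      also have "\<dots> = 4 powr a * rho e z x powr (- a)"
        using rho_pos[OF e, of z x] by (simp add: powr_divide powr_minus_divide)
      finally have "rho e z ((1 / 2) *\<^sub>R z + (1 / 2) *\<^sub>R x) powr (- a) \<le> 4 powr a * rho e z x powr (- a)" .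
      moreover have "(1 / 2) *\<^sub>R z + (1 / 2) *\<^sub>R x \<in> cball z (R / 2) \<longleftrightarrow> x \<in> cball z R"
        using n by (simp add: dist_norm norm_minus_commute)
      ultimately show "indicator (cball z (R / 2)) ((1 / 2) *\<^sub>R z + (1 / 2) *\<^sub>R x)
        * rho e z ((1 / 2) *\<^sub>R z + (1 / 2) *\<^sub>R x) powr (- a) \<le> 4 powr a * (indicator (cball z R) x * rho e z x powr (- a))"
        by (simp add: indicator_def)
    qed (auto intro!: integrable_mult_right integrable_rho_powr e)
    also have "\<dots> = (1 / 2) ^ ?n * 4 powr a * I R" by (simp add: I_def)
    also have "(1 / 2) ^ ?n * 4 powr a = (1 / 16 :: real)"
    proof -
      have "(1 / 2 :: real) ^ ?n = 1 / 2 ^ ?n" by (rule power_one_over)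
      also have "(2 :: real) ^ ?n = 2 powr real ?n" by (rule powr_realpow [symmetric]) simp
      finally have 1: "(1 / 2 :: real) ^ ?n = 1 / 2 powr real ?n" .
      have "(4 :: real) = 2 powr 2" by simp
      hence "(4 :: real) powr a = 2 powr (2 * a)" by (simp only: powr_powr)
      also have "2 * a = real ?n - 4" using a(1) by simp
      also have "2 powr (real ?n - 4) = 2 powr real ?n / (2 powr 4 :: real)" by (rule powr_diff)
      finally show ?thesis unfolding 1 by simp
    qed
    finally show ?thesis by simp
  qed
  finally have "I R \<le> 16 / 15 * (K * R ^ 4)" by simp
  also have "\<dots> \<le> 2 * (K * R ^ 4)" using R by (intro mult_right_mono) (auto simp: K_def)
  finally show "(\<integral>x. indicator (cball z R) x * rho e z x powr (- a) \<partial>lborel) \<le> 2 * K * R ^ 4"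
    by (simp add: I_def)
qed

section \<open>The strong maximum principle\<close>

text \<open>
  Either the first term on the right dominates, or \<open>u\<close> is small enough for the second one to do so.
\<close>

lemma Young_absorb:
  fixes u B k p w :: real
  assumes "0 \<le> u" "0 \<le> B" "0 < k" "0 < p" "0 < w"
  shows "u * B \<le> k * (u powr (1 + p) * w) + B * (B / (k * w)) powr (1 / p)"
proof (cases "B \<le> k * u powr p * w")
  case True
  hence "u * B \<le> u * (k * u powr p * w)" using assms by (intro mult_left_mono)
  also have "\<dots> = k * (u powr (1 + p) * w)" using assms by (simp add: powr_add)
  also have "\<dots> \<le> \<dots> + B * (B / (k * w)) powr (1 / p)" using assms by simp
  finally show ?thesis .
next
  case False
  hence "u powr p \<le> B / (k * w)" using assms by (simp add: field_simps)
  hence "(u powr p) powr (1 / p) \<le> (B / (k * w)) powr (1 / p)"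
    using assms by (intro powr_mono2) auto
  hence "u \<le> (B / (k * w)) powr (1 / p)" using assms by (simp add: powr_powr)
  hence "u * B \<le> (B / (k * w)) powr (1 / p) * B" using assms by (intro mult_right_mono)
  also have "\<dots> \<le> k * (u powr (1 + p) * w) + B * (B / (k * w)) powr (1 / p)" using assms by simp
  finally show ?thesis .
qed

text \<open>
  Young's inequality for the error term. The four missing powers of the cutoff become \<open>a\<close> missing powers
  after raising to \<open>a / 4\<close>, and \<open>m - 4 \<ge> a\<close> leaves no negative power.
\<close>

lemma prof_absorb:
  fixes u k a C :: real
  assumes "0 \<le> u" "0 < k" "0 < a" "0 \<le> C" "0 < t" "0 < q" "5 \<le> m" "a \<le> real m - 4"
  shows "u * (C * (q * prof q (- a) (m - 4) t)) \<le>
    k * (u powr (1 + 4 / a) * prof q (- a) m t) + C * q * (C * q / k) powr (a / 4) * t powr (- a)"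
proof (cases "q * t\<^sup>2 < 1")
  case False
  thus ?thesis using assms by (simp add: prof_def max_def power_0_left)
next
  case True
  define th where "th = 1 - q * t\<^sup>2"
  have th: "0 < th" "th \<le> 1" using True assms by (auto simp: th_def)
  have p: "prof q b l t = t powr b * th ^ l" for b l
    using th by (simp add: prof_def th_def max_def)
  define B where "B = C * (q * prof q (- a) (m - 4) t)"
  have B: "B = C * q * t powr (- a) * th ^ (m - 4)" by (simp add: B_def p)
  have Bn: "0 \<le> B" unfolding B using assms th by simp
  have m4: "th ^ m = th ^ (m - 4) * th ^ 4"
    using assms(7) by (simp flip: power_add)
  have "u * B \<le> k * (u powr (1 + 4 / a) * prof q (- a) m t) + B * (B / (k * prof q (- a) m t)) powr (1 / (4 / a))"
    using assms th Bn by (intro Young_absorb) (auto simp: p)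
  also have "B / (k * prof q (- a) m t) = (C * q / k) / th ^ 4"
    unfolding B p m4 using assms th by simp
  also have "((C * q / k) / th ^ 4) powr (1 / (4 / a)) = (C * q / k) powr (a / 4) * th powr (- a)"
  proof -
    have "(th ^ 4) powr (a / 4) = th powr a"
    proof -
      have "th ^ 4 = th powr 4" using th by simp
      thus ?thesis by (simp only: powr_powr) simp
    qed
    thus ?thesis using assms th by (subst powr_divide) (simp_all add: powr_minus_divide)
  qed
  also have "B * ((C * q / k) powr (a / 4) * th powr (- a)) =
      C * q * (C * q / k) powr (a / 4) * t powr (- a) * th powr (real (m - 4) - a)"
    unfolding B using th by (simp add: powr_diff powr_minus_divide powr_realpow)
  also have "\<dots> \<le> C * q * (C * q / k) powr (a / 4) * t powr (- a) * 1"
    using assms th by (intro mult_left_mono powr_le1) (auto simp: of_nat_diff)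
  finally show ?thesis by (simp add: B_def)
qed

text \<open>
  As \<open>e\<close> tends to 0 the functions \<open>e\<^sup>2 (e + \<bar>x - z\<bar>\<^sup>2)\<^sup>-\<^sup>a\<^sup>-\<^sup>4\<close> have bounded mass, all of which concentrates
  at \<open>z\<close>, where \<open>v\<close> vanishes: near \<open>z\<close> the function \<open>v\<close> is small, and far from \<open>z\<close> the factor \<open>e\<^sup>2\<close>
  wins.
\<close>

lemma integral_concentrating_le:
  fixes v :: "real^'n \<Rightarrow> real"
  assumes v: "continuous_on UNIV v" "\<And>x. 0 \<le> v x" "v z = 0"
    and a: "0 < a" and T: "0 < T" and m: "0 < m" and H: "0 < H"
    and bound: "\<And>e. 0 < e \<Longrightarrow> (\<integral>x. e\<^sup>2 * prof (1 / T ^ 4) (- a - 4) m (rho e z x) \<partial>lborel) \<le> H"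
    and h: "0 < h"
  obtains e where "0 < e" "e \<le> 1"
    "(\<integral>x. v x * (e\<^sup>2 * prof (1 / T ^ 4) (- a - 4) m (rho e z x)) \<partial>lborel) \<le> h"
proof -
  let ?B = "cball z T"
  obtain M where M: "0 \<le> M" "\<And>x. x \<in> ?B \<Longrightarrow> \<bar>v x\<bar> \<le> M"
    by (rule bounded_on_compact[OF v(1), of ?B]) auto
  define \<eta> where "\<eta> = h / (2 * H)"
  have \<eta>: "0 < \<eta>" using h H by (simp add: \<eta>_def)
  have "isCont v z" using v(1) by (simp add: continuous_on_eq_continuous_at)
  then obtain d where d: "0 < d" "\<And>x. dist x z < d \<Longrightarrow> dist (v x) (v z) < \<eta>"
    using \<eta> unfolding continuous_at_eps_delta by metis
  define A where "A = M * (d\<^sup>2) powr (- a - 4) * measure lborel ?B"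
  have A: "0 \<le> A" using M by (simp add: A_def)
  define e where "e = min 1 (h / (2 * (A + 1)))"
  have e: "0 < e" "e \<le> 1" using h A by (auto simp: e_def)
  have "e\<^sup>2 * A \<le> e * (A + 1)"
    using e A by (intro mult_mono) (auto simp: power2_eq_square mult_left_le)
  also have "\<dots> \<le> h / (2 * (A + 1)) * (A + 1)"
    using A by (intro mult_right_mono) (auto simp: e_def)
  also have "\<dots> = h / 2" using A by (simp add: field_simps)
  finally have eA: "e\<^sup>2 * A \<le> h / 2" .
  let ?P = "\<lambda>x. prof (1 / T ^ 4) (- a - 4) m (rho e z x)"
  have cP: "continuous_on UNIV ?P" by (rule continuous_on_prof_rho[OF e(1) m])
  have P0: "?P x = 0" if "x \<notin> ?B" for x by (rule prof_rho_outside[OF e(1) T m that])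
  have i1: "integrable lborel (\<lambda>x. v x * (e\<^sup>2 * ?P x))"
    by (rule integrable_compact_support[OF _ compact_cball[of z T]]) (use v(1) cP P0 in \<open>auto intro!: continuous_intros\<close>)
  have i2: "integrable lborel (\<lambda>x. e\<^sup>2 * ?P x)"
    by (rule integrable_compact_support[OF _ compact_cball[of z T]]) (use cP P0 in \<open>auto intro!: continuous_intros\<close>)
  have i3: "integrable lborel (\<lambda>x. indicator ?B x :: real)"
    using emeasure_bounded_finite[of ?B] by (intro integrable_real_indicator) auto
  have "(\<integral>x. v x * (e\<^sup>2 * ?P x) \<partial>lborel) \<le>
      (\<integral>x. \<eta> * (e\<^sup>2 * ?P x) + (e\<^sup>2 * M * (d\<^sup>2) powr (- a - 4)) * indicator ?B x \<partial>lborel)"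
  proof (rule Bochner_Integration.integral_mono[OF i1])
    show "integrable lborel (\<lambda>x. \<eta> * (e\<^sup>2 * ?P x) + (e\<^sup>2 * M * (d\<^sup>2) powr (- a - 4)) * indicator ?B x)"
      using i2 i3 by (intro Bochner_Integration.integrable_add integrable_mult_right) auto
    fix x
    have Pn: "0 \<le> ?P x" by (rule prof_nonneg)
    consider "x \<notin> ?B" | "dist x z < d" | "x \<in> ?B" "d \<le> dist x z" by linarith
    thus "v x * (e\<^sup>2 * ?P x) \<le> \<eta> * (e\<^sup>2 * ?P x) + (e\<^sup>2 * M * (d\<^sup>2) powr (- a - 4)) * indicator ?B x"
    proof cases
      case 1
      thus ?thesis using P0 by simp
    next
      case 2
      have "v x \<le> \<eta>" using d(2)[OF 2] v(3) by (simp add: dist_real_def)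
      hence "v x * (e\<^sup>2 * ?P x) \<le> \<eta> * (e\<^sup>2 * ?P x)"
        using Pn by (intro mult_right_mono) auto
      moreover have "0 \<le> (e\<^sup>2 * M * (d\<^sup>2) powr (- a - 4)) * indicator ?B x"
        using M by simp
      ultimately show ?thesis by linarith
    next
      case 3
      have "d\<^sup>2 \<le> (norm (x - z))\<^sup>2" using 3 d(1) by (intro power_mono) (auto simp: dist_norm)
      hence "d\<^sup>2 \<le> rho e z x" using e by (simp add: rho_def)
      hence "rho e z x powr (- a - 4) \<le> (d\<^sup>2) powr (- a - 4)"
        using d(1) a by (intro powr_mono2') auto
      hence "?P x \<le> (d\<^sup>2) powr (- a - 4)"
        using prof_le_powr[of "1 / T ^ 4" "- a - 4" m "rho e z x"] T by simp
      hence "v x * (e\<^sup>2 * ?P x) \<le> M * (e\<^sup>2 * (d\<^sup>2) powr (- a - 4))"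
        using M(1) M(2)[OF 3(1)] Pn by (intro mult_mono mult_left_mono) auto
      moreover have "0 \<le> \<eta> * (e\<^sup>2 * ?P x)" using \<eta> Pn by simp
      ultimately show ?thesis using 3(1) by (simp add: algebra_simps)
    qed
  qed
  also have "\<dots> = \<eta> * (\<integral>x. e\<^sup>2 * ?P x \<partial>lborel) + e\<^sup>2 * A"
  proof -
    have "(\<integral>x. (e\<^sup>2 * M * (d\<^sup>2) powr (- a - 4)) * indicator ?B x \<partial>lborel) = e\<^sup>2 * A"
      by (simp add: A_def)
    moreover have "(\<integral>x. \<eta> * (e\<^sup>2 * ?P x) \<partial>lborel) = \<eta> * (\<integral>x. e\<^sup>2 * ?P x \<partial>lborel)"
      by (rule integral_mult_right_zero)
    moreover have "integrable lborel (\<lambda>x. \<eta> * (e\<^sup>2 * ?P x))"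
      "integrable lborel (\<lambda>x. (e\<^sup>2 * M * (d\<^sup>2) powr (- a - 4)) * indicator ?B x)"
      by (rule integrable_mult_right[OF i2], rule integrable_mult_right[OF i3])
    ultimately show ?thesis by (simp only: Bochner_Integration.integral_add)
  qed
  also have "\<dots> \<le> \<eta> * H + h / 2"
    using bound[OF e(1)] \<eta> eA by (intro add_mono mult_left_mono) auto
  also have "\<dots> = h" using H by (simp add: \<eta>_def)
  finally show ?thesis using that e by blast
qed

text \<open>
  The strong maximum principle for \<open>\<Delta>\<^sup>2 v \<ge> K v\<^sup>s\<close>. If \<open>v y > 0\<close> for some \<open>y\<close>, then testing with the
  functions of \<open>bilaplacian_prof\<close> centred at the zero \<open>z\<close> bounds a fixed positive number by a constant
  times \<open>T\<^sup>-\<^sup>a\<close> for every large \<open>T\<close>.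
\<close>

lemma supersolution_zero_imp_zero:
  fixes v F :: "real^'n \<Rightarrow> real"
  assumes n: "5 \<le> CARD('n)"
    and v: "continuous_on UNIV v" "Ck_on 4 (UNIV - {0}) v" "\<And>x. 0 \<le> v x"
    and F: "continuous_on UNIV F" "\<And>x. x \<noteq> 0 \<Longrightarrow> laplacian (laplacian v) x = F x"
    and K: "0 < K" "\<And>x. K * v x powr (1 + 8 / (real CARD('n) - 4)) \<le> F x"
    and z: "v z = 0"
  shows "v y = 0"
proof (rule ccontr)
  assume "v y \<noteq> 0"
  hence vy: "0 < v y" using v(3)[of y] by simp
  let ?n = "CARD('n)"
  define a where "a = (real ?n - 4) / 2"
  have a: "0 < a" using n by (simp add: a_def)
  define s where "s = 1 + 4 / a"
  have s: "s = 1 + 8 / (real ?n - 4)" "0 < s" using n a by (auto simp: s_def a_def field_simps)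
  define m where "m = ?n"
  have m: "5 \<le> m" "0 < m" "a \<le> real m - 4" using n by (auto simp: m_def a_def)
  define c0 where "c0 = 16 * a * (a + 1) * (a + 2) * (a + 3)"
  have c0: "0 < c0" using a by (simp add: c0_def)
  obtain C where C: "0 \<le> C" "\<And>e q x. 0 < e \<Longrightarrow> 0 \<le> q \<Longrightarrow>
    \<bar>laplacian (laplacian (\<lambda>x. prof q (- a) m (rho e z x))) x - c0 * (e\<^sup>2 * prof q (- a - 4) m (rho e z x))\<bar>
    \<le> C * (q * prof q (- a) (m - 4) (rho e z x))"
    using bilaplacian_prof[OF m(1) a_def, of z] unfolding c0_def by metis
  obtain C' where C': "0 \<le> C'" "\<And>e R. 0 < e \<Longrightarrow> 0 < R \<Longrightarrow>
    (\<integral>x. indicator (cball z R) x * rho e z x powr (- a) \<partial>lborel) \<le> C' * R ^ 4"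
    using integral_rho_powr_le[OF a_def a, of z] by metis
  \<comment> \<open>Half of the nonlinear term is kept to absorb the error terms.\<close>
  define k where "k = K / 2"
  have k: "0 < k" using K by (simp add: k_def)

  have "isCont v y" using v(1) by (simp add: continuous_on_eq_continuous_at)
  then obtain r where r: "0 < r" "\<And>x. dist x y < r \<Longrightarrow> dist (v x) (v y) < v y / 2"
    using half_gt_zero[OF vy] unfolding continuous_at_eps_delta by metis
  define r' where "r' = r / 2"
  have r': "0 < r'" using r by (simp add: r'_def)
  have vr: "v y / 2 \<le> v x" if "x \<in> cball y r'" for x
    using r(2)[of x] that r(1) by (auto simp: dist_real_def r'_def dist_commute abs_if split: if_splits)
  \<comment> \<open>An upper bound for \<open>e + \<bar>x - z\<bar>\<^sup>2\<close> near \<open>y\<close>, valid for all \<open>e \<le> 1\<close>; from it the test functions get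
    a lower bound there that does not depend on \<open>e\<close> and \<open>T\<close>.\<close>
  define S where "S = 1 + (dist y z + r')\<^sup>2"
  have S: "0 < S" unfolding S_def using zero_le_power2[of "dist y z + r'"] by linarith
  define L where "L = (v y / 2) powr s * (S powr (- a) * (1 / 2) ^ m) * measure lborel (cball y r')"
  have L: "0 < L"
  proof -
    have "0 < measure lborel (cball y r')"
      using content_cball[of r' y] r' by simp
    thus ?thesis using vy S by (simp add: L_def)
  qed

  define D where "D T = C * (C / k) powr (a / 4) * C' * T powr (- a)" for T
  have key: "k * L \<le> D T" if T: "1 \<le> T" "2 * S\<^sup>2 \<le> T ^ 4" for T
  proof -
    define q where "q = 1 / T ^ 4"
    have q: "0 < q" "0 \<le> q" "q * T ^ 4 = 1" using T by (auto simp: q_def)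
    have T0: "0 < T" using T by simp
    let ?B = "cball z T"
    have out: "prof q b l (rho e z x) = 0" if "0 < e" "0 < l" "x \<notin> ?B" for b l e x
      unfolding q_def by (rule prof_rho_outside[OF that(1) T0 that(2,3)])
    have ip: "integrable lborel (\<lambda>x. prof q b l (rho e z x))" if "0 < e" "0 < l" for b l e
      by (rule integrable_compact_support[OF continuous_on_prof_rho[OF that] compact_cball[of z T]])
         (rule out[OF that])
    have Ck: "Ck_on 4 UNIV (\<lambda>x. prof q (- a) m (rho e z x))" if "0 < e" for e
      using that m by (intro Ck_on_prof_rho) auto
    have cD: "continuous_on UNIV (laplacian (laplacian (\<lambda>x. prof q (- a) m (rho e z x))))" if "0 < e" for e
      by (rule continuous_on_bilaplacian[OF open_UNIV Ck[OF that]])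
    have D0: "laplacian (laplacian (\<lambda>x. prof q (- a) m (rho e z x))) x = 0" if "0 < e" "x \<notin> ?B" for e x
      using that m by (intro laplacian_outside[OF closed_cball[of z T]] out) auto
    have tail: "q * (\<integral>x. prof q (- a) (m - 4) (rho e z x) \<partial>lborel) \<le> C'" if e: "0 < e" for e
    proof -
      have "(\<integral>x. prof q (- a) (m - 4) (rho e z x) \<partial>lborel) \<le>
          (\<integral>x. indicator ?B x * rho e z x powr (- a) \<partial>lborel)"
      proof (rule Bochner_Integration.integral_mono[OF ip[OF e] integrable_rho_powr[OF e]])
        fix x
        show "prof q (- a) (m - 4) (rho e z x) \<le> indicator ?B x * rho e z x powr (- a)"
          using out[OF e, of "m - 4" x "- a"] m prof_le_powr[OF q(2)] by (auto simp: indicator_def)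
      qed (use m in auto)
      also have "\<dots> \<le> C' * T ^ 4" by (rule C'(2)[OF e T0])
      finally have "q * (\<integral>x. prof q (- a) (m - 4) (rho e z x) \<partial>lborel) \<le> q * (C' * T ^ 4)"
        using q by (intro mult_left_mono)
      also have "\<dots> = C' * (q * T ^ 4)" by (simp only: mult_ac)
      finally show ?thesis using q(3) by simp
    qed
    \<comment> \<open>The mass of the regularized point mass is bounded without computing it: the bilaplacian of the test
      function has integral 0, so up to sign its main part has the same integral as the error part. Adding 1 makes
      the bound positive.\<close>
    have mass: "(\<integral>x. e\<^sup>2 * prof q (- a - 4) m (rho e z x) \<partial>lborel) \<le> C * C' / c0 + 1" if e: "0 < e" for e
    proof -
      let ?E = "\<lambda>x. laplacian (laplacian (\<lambda>x. prof q (- a) m (rho e z x))) x"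
      have iE: "integrable lborel ?E"
        by (rule integrable_compact_support[OF cD[OF e] compact_cball[of z T] D0[OF e]])
      have "(\<integral>x. c0 * (e\<^sup>2 * prof q (- a - 4) m (rho e z x)) \<partial>lborel)
          \<le> (\<integral>x. ?E x + C * (q * prof q (- a) (m - 4) (rho e z x)) \<partial>lborel)"
      proof (rule Bochner_Integration.integral_mono)
        show "integrable lborel (\<lambda>x. c0 * (e\<^sup>2 * prof q (- a - 4) m (rho e z x)))"
          by (intro integrable_mult_right ip e m)
        show "integrable lborel (\<lambda>x. ?E x + C * (q * prof q (- a) (m - 4) (rho e z x)))"
          using m by (intro Bochner_Integration.integrable_add iE integrable_mult_right ip e) auto
        fix x
        show "c0 * (e\<^sup>2 * prof q (- a - 4) m (rho e z x)) \<le> ?E x + C * (q * prof q (- a) (m - 4) (rho e z x))"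
          using C(2)[OF e q(2), of x] by linarith
      qed
      also have "\<dots> = (\<integral>x. ?E x \<partial>lborel) + C * (q * (\<integral>x. prof q (- a) (m - 4) (rho e z x) \<partial>lborel))"
        using iE ip[OF e, of "m - 4" "- a"] m by simp
      also have "(\<integral>x. ?E x \<partial>lborel) = 0"
        using m by (intro integral_bilaplacian_eq_0[OF Ck[OF e] compact_cball[of z T]] out e) auto
      also have "0 + C * (q * (\<integral>x. prof q (- a) (m - 4) (rho e z x) \<partial>lborel)) \<le> C * C'"
        using tail[OF e] C(1) by (simp add: mult_left_mono)
      finally have "(\<integral>x. e\<^sup>2 * prof q (- a - 4) m (rho e z x) \<partial>lborel) \<le> C * C' / c0"
        using c0 by (simp add: field_simps)
      thus ?thesis by simp
    qed
    \<comment> \<open>The term with \<open>h\<close> is what the regularized point mass sees of \<open>v\<close>; it disappears as \<open>e\<close> tends to 0.\<close>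
    have "k * L \<le> D T + c0 * h" if h: "0 < h" for h
    proof -
      have H: "0 < C * C' / c0 + 1"
        using C(1) C'(1) c0 by (intro add_nonneg_pos divide_nonneg_pos mult_nonneg_nonneg) auto
      obtain e where e: "0 < e" "e \<le> 1"
        and J: "(\<integral>x. v x * (e\<^sup>2 * prof q (- a - 4) m (rho e z x)) \<partial>lborel) \<le> h"
        using integral_concentrating_le[OF v(1,3) z a T0 m(2) H mass[unfolded q_def] h] unfolding q_def by metis
      define \<phi> where "\<phi> x = prof q (- a) m (rho e z x)" for x
      have \<phi>: "Ck_on 4 UNIV \<phi>" "continuous_on UNIV \<phi>" "\<And>x. x \<notin> ?B \<Longrightarrow> \<phi> x = 0" "\<And>x. 0 \<le> \<phi> x"
        using Ck[OF e(1)] continuous_on_prof_rho[OF e(1) m(2)] out[OF e(1) m(2)]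
        by (simp_all add: \<phi>_def [abs_def] prof_nonneg)
      have vs: "continuous_on UNIV (\<lambda>x. v x powr s)"
        using v s by (intro continuous_on_powr' continuous_on_const) auto
      have ivs: "integrable lborel (\<lambda>x. v x powr s * \<phi> x)"
        by (rule integrable_compact_support[OF _ compact_cball[of z T]])
           (use vs \<phi> in \<open>auto intro!: continuous_on_mult\<close>)
      have iF: "integrable lborel (\<lambda>x. F x * \<phi> x)"
        by (rule integrable_compact_support[OF _ compact_cball[of z T]])
           (use F(1) \<phi> in \<open>auto intro!: continuous_on_mult\<close>)
      have iE: "integrable lborel (\<lambda>x. v x * laplacian (laplacian \<phi>) x)"
        by (rule integrable_compact_support[OF _ compact_cball[of z T]])
           (use v(1) cD[OF e(1)] D0[OF e(1)] in \<open>auto intro!: continuous_on_mult simp: \<phi>_def [abs_def]\<close>)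
      have iJ: "integrable lborel (\<lambda>x. v x * (e\<^sup>2 * prof q (- a - 4) m (rho e z x)))"
        by (rule integrable_compact_support[OF _ compact_cball[of z T]])
           (use v(1) continuous_on_prof_rho[OF e(1) m(2)] out[OF e(1) m(2)] in \<open>auto intro!: continuous_intros\<close>)
      define Q where "Q = C * q * (C * q / k) powr (a / 4)"
      have Q: "0 \<le> Q" using C(1) q k by (simp add: Q_def)
      have "2 * k * (\<integral>x. v x powr s * \<phi> x \<partial>lborel) = (\<integral>x. K * (v x powr s * \<phi> x) \<partial>lborel)"
        by (simp add: k_def)
      also have "\<dots> \<le> (\<integral>x. F x * \<phi> x \<partial>lborel)"
      proof (rule Bochner_Integration.integral_mono[OF _ iF])
        fix x
        have "(K * v x powr s) * \<phi> x \<le> F x * \<phi> x"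
          using K(2)[of x] \<phi>(4)[of x] unfolding s(1) by (intro mult_right_mono)
        thus "K * (v x powr s * \<phi> x) \<le> F x * \<phi> x" by (simp add: mult.assoc)
      qed (intro integrable_mult_right ivs)
      also have "\<dots> = (\<integral>x. v x * laplacian (laplacian \<phi>) x \<partial>lborel)"
        by (rule Green_bilaplacian_puncture[OF n v(1,2) F \<phi>(1) compact_cball[of z T] \<phi>(3)])
      also have "\<dots> \<le> (\<integral>x. c0 * (v x * (e\<^sup>2 * prof q (- a - 4) m (rho e z x))) + k * (v x powr s * \<phi> x)
          + Q * (indicator ?B x * rho e z x powr (- a)) \<partial>lborel)"
      proof (rule Bochner_Integration.integral_mono[OF iE])
        show "integrable lborel (\<lambda>x. c0 * (v x * (e\<^sup>2 * prof q (- a - 4) m (rho e z x))) + k * (v x powr s * \<phi> x)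
          + Q * (indicator ?B x * rho e z x powr (- a)))"
          by (intro Bochner_Integration.integrable_add integrable_mult_right iJ ivs integrable_rho_powr e)
        fix x
        show "v x * laplacian (laplacian \<phi>) x \<le> c0 * (v x * (e\<^sup>2 * prof q (- a - 4) m (rho e z x)))
          + k * (v x powr s * \<phi> x) + Q * (indicator ?B x * rho e z x powr (- a))"
        proof (cases "x \<in> ?B")
          case True
          have "laplacian (laplacian \<phi>) x \<le> c0 * (e\<^sup>2 * prof q (- a - 4) m (rho e z x))
              + C * (q * prof q (- a) (m - 4) (rho e z x))"
            using C(2)[OF e(1) q(2), of x] unfolding \<phi>_def [abs_def] by linarith
          hence "v x * laplacian (laplacian \<phi>) x \<le> v x * (c0 * (e\<^sup>2 * prof q (- a - 4) m (rho e z x))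
              + C * (q * prof q (- a) (m - 4) (rho e z x)))"
            using v(3) by (intro mult_left_mono)
          also have "\<dots> = c0 * (v x * (e\<^sup>2 * prof q (- a - 4) m (rho e z x)))
              + v x * (C * (q * prof q (- a) (m - 4) (rho e z x)))"
            by (simp add: algebra_simps)
          also have "v x * (C * (q * prof q (- a) (m - 4) (rho e z x))) \<le>
              k * (v x powr s * \<phi> x) + Q * rho e z x powr (- a)"
            unfolding s_def \<phi>_def Q_def
            by (rule prof_absorb[OF v(3) k a C(1) rho_pos[OF e(1)] q(1) m(1,3)])
          finally show ?thesis using True by simp
        next
          case False
          have "laplacian (laplacian \<phi>) x = 0" using D0[OF e(1) False] by (simp add: \<phi>_def [abs_def])
          moreover have "prof q (- a - 4) m (rho e z x) = 0" by (rule out[OF e(1) m(2) False])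
          ultimately show ?thesis using False \<phi>(3)[OF False] by simp
        qed
      qed
      also have "\<dots> = c0 * (\<integral>x. v x * (e\<^sup>2 * prof q (- a - 4) m (rho e z x)) \<partial>lborel)
          + k * (\<integral>x. v x powr s * \<phi> x \<partial>lborel) + Q * (\<integral>x. indicator ?B x * rho e z x powr (- a) \<partial>lborel)"
        using iJ ivs integrable_rho_powr[OF e(1), of z T "- a"]
        by (simp only: Bochner_Integration.integral_add Bochner_Integration.integrable_add integrable_mult_right integral_mult_right_zero)
      also have "\<dots> \<le> c0 * h + k * (\<integral>x. v x powr s * \<phi> x \<partial>lborel) + Q * (C' * T ^ 4)"
        using J C'(2)[OF e(1) T0] c0 Q by (intro add_mono mult_left_mono order_refl) auto
      also have "Q * (C' * T ^ 4) = D T"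
      proof -
        have "(C * q / k) powr (a / 4) = (C / k * q) powr (a / 4)" by simp
        also have "\<dots> = (C / k) powr (a / 4) * q powr (a / 4)"
          using C(1) k q by (intro powr_mult)
        also have "q powr (a / 4) = T powr (- a)"
        proof -
          have "q = T powr (- 4)" using T0 by (simp add: q_def powr_minus_divide)
          thus ?thesis by (simp only: powr_powr) simp
        qed
        finally have "Q * (C' * T ^ 4) = C * ((C / k) powr (a / 4) * T powr (- a)) * C' * (q * T ^ 4)"
          unfolding Q_def by (simp only: mult_ac)
        thus ?thesis unfolding q(3) D_def by (simp only: mult_ac mult_1_right)
      qed
      finally have "k * (\<integral>x. v x powr s * \<phi> x \<partial>lborel) \<le> D T + c0 * h" by simp
      moreover have "L \<le> (\<integral>x. v x powr s * \<phi> x \<partial>lborel)"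
      proof -
        have "L = (\<integral>x. (v y / 2) powr s * (S powr (- a) * (1 / 2) ^ m) * indicator (cball y r') x \<partial>lborel)"
          by (simp add: L_def)
        also have "\<dots> \<le> (\<integral>x. v x powr s * \<phi> x \<partial>lborel)"
        proof (rule Bochner_Integration.integral_mono[OF _ ivs])
          show "integrable lborel (\<lambda>x. (v y / 2) powr s * (S powr (- a) * (1 / 2) ^ m) * indicator (cball y r') x)"
            using emeasure_bounded_finite[of "cball y r'"]
            by (intro integrable_mult_right integrable_real_indicator) auto
          fix x
          show "(v y / 2) powr s * (S powr (- a) * (1 / 2) ^ m) * indicator (cball y r') x \<le> v x powr s * \<phi> x"
          proof (cases "x \<in> cball y r'")
            case True
            have "norm (x - z) \<le> dist y z + r'"
              using True dist_triangle[of x z y] by (simp add: dist_norm [symmetric] dist_commute)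
            hence "(norm (x - z))\<^sup>2 \<le> (dist y z + r')\<^sup>2" by (intro power_mono) auto
            hence rS: "rho e z x \<le> S" using e(2) by (simp add: rho_def S_def)
            have "S powr (- a) \<le> rho e z x powr (- a)"
              using rS a rho_pos[OF e(1), of z x] by (intro powr_mono2') auto
            moreover have "1 / 2 \<le> max 0 (1 - q * (rho e z x)\<^sup>2)"
            proof -
              have "(rho e z x)\<^sup>2 \<le> S\<^sup>2" using rS rho_pos[OF e(1), of z x] by (intro power_mono) auto
              hence "q * (rho e z x)\<^sup>2 \<le> q * (T ^ 4 / 2)" using T(2) q by (intro mult_left_mono) auto
              also have "\<dots> = 1 / 2" using q(3) by simp
              finally show ?thesis unfolding le_max_iff_disj by linarith
            qed
            hence "(1 / 2) ^ m \<le> max 0 (1 - q * (rho e z x)\<^sup>2) ^ m" by (rule power_mono) simp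
            ultimately have "S powr (- a) * (1 / 2) ^ m \<le> \<phi> x"
              unfolding \<phi>_def prof_def by (intro mult_mono) auto
            moreover have "(v y / 2) powr s \<le> v x powr s"
              using vr[OF True] vy s(2) by (intro powr_mono2) auto
            ultimately have "(v y / 2) powr s * (S powr (- a) * (1 / 2) ^ m) \<le> v x powr s * \<phi> x"
              by (intro mult_mono) auto
            thus ?thesis using True by simp
          next
            case False
            thus ?thesis using \<phi>(4)[of x] by simp
          qed
        qed
        finally show ?thesis .
      qed
      hence "k * L \<le> k * (\<integral>x. v x powr s * \<phi> x \<partial>lborel)" using k by (intro mult_left_mono) auto
      ultimately show ?thesis by linarith
    qed
    hence "k * L \<le> D T + d" if "0 < d" for d
      using that c0 by (metis divide_pos_pos nonzero_mult_div_cancel_left less_irrefl times_divide_eq_right)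
    thus ?thesis by (rule field_le_epsilon)
  qed
  have "(D \<longlongrightarrow> C * (C / k) powr (a / 4) * C' * 0) at_top"
    unfolding D_def [abs_def] using a
    by (intro tendsto_intros tendsto_neg_powr filterlim_ident) auto
  moreover have "eventually (\<lambda>T. k * L \<le> D T) at_top"
  proof -
    have "eventually (\<lambda>T. 1 \<le> T \<and> 2 * S\<^sup>2 \<le> T) at_top"
      by (intro eventually_conj eventually_ge_at_top)
    thus ?thesis
    proof (rule eventually_mono)
      fix T :: real assume T: "1 \<le> T \<and> 2 * S\<^sup>2 \<le> T"
      have "T ^ 1 \<le> T ^ 4" using T by (intro power_increasing) auto
      thus "k * L \<le> D T" using T by (intro key) auto
    qed
  qed
  ultimately have "k * L \<le> C * (C / k) powr (a / 4) * C' * 0"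
    by (intro tendsto_lowerbound) auto
  thus False using k L by (simp add: mult_le_0_iff)
qed

theorem corollary19:
  fixes U :: "real^'n \<Rightarrow> real^'p"
  assumes "CARD('n) \<ge> 5"
    and "classical_solution U"
    and "nonnegative U"
    and "non_singular U"
  shows "(\<forall>i. (\<forall>x. extension U x $ i = 0) \<or> (\<forall>x. extension U x $ i > 0)) \<and>
         (UNIV :: 'p set) = {i. \<forall>x. extension U x $ i = 0} \<union> {i. \<forall>x. extension U x $ i > 0} \<and>
         {i. \<forall>x. extension U x $ i = 0} \<inter> {i. \<forall>x. extension U x $ i > 0} = {}"
proof -
  let ?n = "CARD('n)"
  obtain V where V: "continuous_on UNIV V" "\<forall>x\<in>UNIV - {0}. V x = U x"
    using assms(4) unfolding non_singular_def by blast
  have ext: "extension U = V" by (rule extension_eq[OF V])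
  define p where "p = crit_exp ?n - 2"
  have p: "p = 8 / (real ?n - 4)" "0 < p"
    using assms(1) by (auto simp: p_def crit_exp_def field_simps)
  have c: "0 < c_const ?n"
  proof -
    have "5 ^ 2 \<le> (real ?n)\<^sup>2" using assms(1) by (intro power_mono) auto
    thus ?thesis using assms(1) by (simp add: c_const_def)
  qed
  have op: "open (UNIV - {0 :: real^'n})" by (simp add: open_delete)
  have alt: "(\<forall>x. V x $ i = 0) \<or> (\<forall>x. V x $ i > 0)" for i
  proof -
    let ?v = "\<lambda>x. V x $ i"
    have cv: "continuous_on UNIV ?v" using V(1) by (intro continuous_intros)
    have v0: "0 \<le> ?v x" if "x \<noteq> 0" for x
      using assms(3) V(2) that by (simp add: nonnegative_def)
    have v: "0 \<le> ?v x" for x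
    proof (cases "x = 0")
      case True
      have "(?v \<longlongrightarrow> ?v 0) (at 0)" using cv by (simp add: continuous_on_def)
      moreover have "eventually (\<lambda>x. 0 \<le> ?v x) (at 0)"
        using v0 by (auto simp: eventually_at_filter)
      ultimately show ?thesis unfolding True by (intro tendsto_lowerbound) auto
    qed (rule v0)
    have eqU: "?v x = U x $ i" if "x \<in> UNIV - {0}" for x using V(2) that by simp
    have "Ck_on 4 (UNIV - {0}) (\<lambda>x. U x $ i)"
      using assms(2) unfolding classical_solution_def Ck_Holder_on_def by blast
    hence Cv: "Ck_on 4 (UNIV - {0}) ?v" using Ck_on_cong[OF op eqU] by simp
    define F where "F x = c_const ?n * norm (V x) powr p * V x $ i" for x
    have cF: "continuous_on UNIV F"
      unfolding F_def using V(1) p(2) by (intro continuous_intros continuous_on_powr') auto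
    have eqF: "laplacian (laplacian ?v) x = F x" if "x \<noteq> 0" for x
    proof -
      have "laplacian (laplacian ?v) x = laplacian (laplacian (\<lambda>y. U y $ i)) x"
        by (rule bilaplacian_cong_open[OF op]) (use that eqU in auto)
      thus ?thesis using assms(2) V(2) that by (simp add: classical_solution_def F_def p_def)
    qed
    \<comment> \<open>The inequality \<open>\<bar>V\<bar> \<ge> v\<close> decouples the system into one inequality for each component.\<close>
    have le: "c_const ?n * ?v x powr (1 + 8 / (real ?n - 4)) \<le> F x" for x
    proof -
      have "?v x powr p \<le> norm (V x) powr p"
        using v[of x] component_le_norm_cart[of "V x" i] p(2) by (intro powr_mono2) auto
      hence "c_const ?n * ?v x powr p * ?v x \<le> F x"
        unfolding F_def using c v by (intro mult_right_mono mult_left_mono) auto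
      moreover have "?v x powr (1 + p) = ?v x powr p * ?v x"
        using v[of x] by (simp add: powr_add mult.commute)
      ultimately show ?thesis unfolding p(1) by (simp add: mult.assoc)
    qed
    show ?thesis
      using supersolution_zero_imp_zero[OF assms(1) cv Cv v cF eqF c le] v
      by (metis less_eq_real_def)
  qed
  show ?thesis unfolding ext using alt by force
qed

end
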